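(* Let $(\mathscr{M};\mathcal{H})$, $(\mathscr{N};\mathcal{K})$ be represented von Neumann algebras and $\Phi:\mathscr{M}\to\mathscr{N}$ be a unital normal $*$-homomorphism. Let $S$ be a densely-defined closed positive operator in $\mathscr{M}_{\mathrm{aff}}$ (so that $\Phi_{\mathrm{aff}}(S)$ is a densely-defined closed positive operator in $\mathscr{N}_{\mathrm{aff}}$). Then $\Phi_{\mathrm{aff}}$ maps the Krein-von Neumann extension (the Friedrichs extension, respectively) of $S$ to the Krein-von Neumann extension (the Friedrichs extension, respectively) of $\Phi_{\mathrm{aff}}(S)$, that is, $$\Phi_{\mathrm{aff}}(S^{\mathbf{Kr}})=\Phi_{\mathrm{aff}}(S)^{\mathbf{Kr}}\quad\text{and}\quad\Phi_{\mathrm{aff}}(S^{\mathbf{Fr}})=\Phi_{\mathrm{aff}}(S)^{\mathbf{Fr}}.$$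
   Context: A represented von Neumann algebra $(\mathscr{M};\mathcal{H})$ is a von Neumann algebra $\mathscr{M}$ acting on a complex Hilbert space $\mathcal{H}$. An unbounded operator on $\mathcal{H}$ is a linear map $T:\mathrm{dom}(T)\to\mathcal{H}$ with $\mathrm{dom}(T)$ a (not necessarily dense) linear subspace of $\mathcal{H}$, and $T$ not necessarily bounded; equality of operators includes equality of domains. For $A,B\in\mathcal{B}(\mathcal{H})$ with $\mathrm{null}(B)\subseteq\mathrm{null}(A)$, the quotient $A/B$ is the unbounded operator with domain $\mathrm{ran}(B)$ given by $Bx\mapsto Ax$ ($x\in\mathcal{H}$). $\mathscr{M}_{\mathrm{aff}} := \{A/B : A,B\in\mathscr{M},\ \mathrm{null}(B)\subseteq\mathrm{null}(A)\}$. The map $\Phi_{\mathrm{aff}}:\mathscr{M}_{\mathrm{aff}}\to\mathscr{N}_{\mathrm{aff}}$, $A/B\mapsto\Phi(A)/\Phi(B)$, makes sense and does not depend on the choice of quotient representation. An operator $S$ is positive if $\langle Sx,x\rangle\ge0$ for all $x\in\mathrm{dom}(S)$. For a densely-defined closed positive operator $S$, order the positive self-adjoint extensions of $S$ by: $S_1\le S_2$ iff $(S_2+I)^{-1}\le(S_1+I)^{-1}$ as bounded operators (equivalently, the Krein transforms $I-2(S_i+I)^{-1}$ satisfy $I-2(S_1+I)^{-1}\le I-2(S_2+I)^{-1}$). The Krein-von Neumann extension $S^{\mathbf{Kr}}$ is the minimal, and the Friedrichs extension $S^{\mathbf{Fr}}$ is the maximal, positive self-adjoint extension of $S$; both exist.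 If $S\in\mathscr{M}_{\mathrm{aff}}$, then both $S^{\mathbf{Kr}}$ and $S^{\mathbf{Fr}}$ belong to $\mathscr{M}_{\mathrm{aff}}$. *)

theory Defs
  imports "HOL-Analysis.Analysis"
begin

section \<open>Complex Hilbert spaces\<close>

text \<open>The inner product is linear in its first argument. Positive definiteness, and the
  compatibility of norm and inner product, are both contained in the last axiom;
  completeness comes from the superclass.\<close>

class complex_hilbert = banach +
  fixes scaleC :: "complex \<Rightarrow> 'a \<Rightarrow> 'a"  (infixr \<open>*\<^sub>C\<close> 75)
    and cinner :: "'a \<Rightarrow> 'a \<Rightarrow> complex"
  assumes scaleC_add_right: "c *\<^sub>C (x + y) = c *\<^sub>C x + c *\<^sub>C y"
    and scaleC_add_left: "(c + d) *\<^sub>C x = c *\<^sub>C x + d *\<^sub>C x"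
    and scaleC_scaleC: "c *\<^sub>C d *\<^sub>C x = (c * d) *\<^sub>C x"
    and scaleR_scaleC: "r *\<^sub>R x = complex_of_real r *\<^sub>C x"
    and cinner_commute: "cinner x y = cnj (cinner y x)"
    and cinner_add_left: "cinner (x + y) z = cinner x z + cinner y z"
    and cinner_scaleC_left: "cinner (c *\<^sub>C x) y = c * cinner x y"
    and cinner_self: "cinner x x = complex_of_real ((norm x)\<^sup>2)"

instantiation complex :: complex_hilbert
begin
definition scaleC_complex :: "complex \<Rightarrow> complex \<Rightarrow> complex"
  where "scaleC_complex c x = c * x"
definition cinner_complex :: "complex \<Rightarrow> complex \<Rightarrow> complex"
  where "cinner_complex x y = x * cnj y"
instance
proof
  fix c d x y z :: complex and r :: real
  show "c *\<^sub>C (x + y) = c *\<^sub>C x + c *\<^sub>C y"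
    by (simp add: scaleC_complex_def distrib_left)
  show "(c + d) *\<^sub>C x = c *\<^sub>C x + d *\<^sub>C x"
    by (simp add: scaleC_complex_def distrib_right)
  show "c *\<^sub>C d *\<^sub>C x = (c * d) *\<^sub>C x"
    by (simp add: scaleC_complex_def)
  show "r *\<^sub>R x = complex_of_real r *\<^sub>C x"
    by (simp add: scaleC_complex_def scaleR_conv_of_real)
  show "cinner x y = cnj (cinner y x)"
    by (simp add: cinner_complex_def mult.commute)
  show "cinner (x + y) z = cinner x z + cinner y z"
    by (simp add: cinner_complex_def distrib_right)
  show "cinner (c *\<^sub>C x) y = c * cinner x y"
    by (simp add: cinner_complex_def scaleC_complex_def)
  show "cinner x x = complex_of_real ((norm x)\<^sup>2)"
    unfolding cinner_complex_def by (rule complex_norm_square [symmetric])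
qed
end

section \<open>Bounded operators and von Neumann algebras\<close>

definition bounded_ops :: "('h::complex_hilbert \<Rightarrow> 'h) set"
  where "bounded_ops = {A. bounded_linear A \<and> (\<forall>c x. A (c *\<^sub>C x) = c *\<^sub>C A x)}"

definition adj :: "('h::complex_hilbert \<Rightarrow> 'h) \<Rightarrow> 'h \<Rightarrow> 'h"
  where "adj A = (THE B. \<forall>x y. cinner (A x) y = cinner x (B y))"

text \<open>Loewner order; it is only used between bounded self-adjoint operators.\<close>

definition op_le :: "('h::complex_hilbert \<Rightarrow> 'h) \<Rightarrow> ('h \<Rightarrow> 'h) \<Rightarrow> bool"
  where "op_le A B \<longleftrightarrow> (\<forall>x. cinner (B x - A x) x \<in> \<real>\<^sub>\<ge>\<^sub>0)"

definition commutant :: "('h::complex_hilbert \<Rightarrow> 'h) set \<Rightarrow> ('h \<Rightarrow> 'h) set"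
  where "commutant M = {A \<in> bounded_ops. \<forall>B\<in>M. A \<circ> B = B \<circ> A}"

text \<open>Dixmier's definition: a self-adjoint set of bounded operators equal to its bicommutant.
  Such a set is automatically a unital subalgebra.\<close>

definition von_neumann_algebra :: "('h::complex_hilbert \<Rightarrow> 'h) set \<Rightarrow> bool"
  where "von_neumann_algebra M \<longleftrightarrow>
    M \<subseteq> bounded_ops \<and> (\<forall>A\<in>M. adj A \<in> M) \<and> commutant (commutant M) = M"

definition self_adjoint_part :: "('h::complex_hilbert \<Rightarrow> 'h) set \<Rightarrow> ('h \<Rightarrow> 'h) set"
  where "self_adjoint_part M = {A \<in> M. adj A = A}"

definition unital_star_hom ::
    "('h::complex_hilbert \<Rightarrow> 'h) set \<Rightarrow> ('k::complex_hilbert \<Rightarrow> 'k) set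
      \<Rightarrow> (('h \<Rightarrow> 'h) \<Rightarrow> ('k \<Rightarrow> 'k)) \<Rightarrow> bool"
  where "unital_star_hom M N \<Phi> \<longleftrightarrow>
    (\<forall>A\<in>M. \<Phi> A \<in> N) \<and>
    (\<forall>A\<in>M. \<forall>B\<in>M. \<Phi> (\<lambda>x. A x + B x) = (\<lambda>x. \<Phi> A x + \<Phi> B x)) \<and>
    (\<forall>c. \<forall>A\<in>M. \<Phi> (\<lambda>x. c *\<^sub>C A x) = (\<lambda>x. c *\<^sub>C \<Phi> A x)) \<and>
    (\<forall>A\<in>M. \<forall>B\<in>M. \<Phi> (A \<circ> B) = \<Phi> A \<circ> \<Phi> B) \<and>
    (\<forall>A\<in>M. \<Phi> (adj A) = adj (\<Phi> A)) \<and>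
    \<Phi> id = id"

definition is_lub_in ::
    "('h::complex_hilbert \<Rightarrow> 'h) set \<Rightarrow> ('h \<Rightarrow> 'h) set \<Rightarrow> ('h \<Rightarrow> 'h) \<Rightarrow> bool"
  where "is_lub_in X D T \<longleftrightarrow>
    T \<in> X \<and> (\<forall>A\<in>D. op_le A T) \<and> (\<forall>U\<in>X. (\<forall>A\<in>D. op_le A U) \<longrightarrow> op_le T U)"

text \<open>Normality: suprema of bounded increasing nets of self-adjoint elements are preserved.
  Since only the range of such a net matters, nets are replaced by upward directed sets.\<close>

definition normal_map ::
    "('h::complex_hilbert \<Rightarrow> 'h) set \<Rightarrow> ('k::complex_hilbert \<Rightarrow> 'k) set
      \<Rightarrow> (('h \<Rightarrow> 'h) \<Rightarrow> ('k \<Rightarrow> 'k)) \<Rightarrow> bool"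
  where "normal_map M N \<Phi> \<longleftrightarrow>
    (\<forall>D T. D \<subseteq> self_adjoint_part M \<and> D \<noteq> {} \<and>
       (\<forall>A\<in>D. \<forall>B\<in>D. \<exists>C\<in>D. op_le A C \<and> op_le B C) \<and>
       is_lub_in (self_adjoint_part M) D T
       \<longrightarrow> is_lub_in (self_adjoint_part N) (\<Phi> ` D) (\<Phi> T))"

section \<open>Unbounded operators\<close>

text \<open>An unbounded operator is identified with its graph, so that equality of operators includes
  equality of domains, extension is inclusion, the domain of \<open>T\<close> is \<open>Domain T\<close>, and a closed
  operator is one that is a closed subset of the product space.\<close>

definition unbounded_op :: "('h::complex_hilbert \<times> 'h) set \<Rightarrow> bool"
  where "unbounded_op T \<longleftrightarrow>
    (0, 0) \<in> T \<and>
    (\<forall>x y x' y'. (x, y) \<in> T \<and> (x', y') \<in> T \<longrightarrow> (x + x', y + y') \<in> T) \<and>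
    (\<forall>c x y. (x, y) \<in> T \<longrightarrow> (c *\<^sub>C x, c *\<^sub>C y) \<in> T) \<and>
    single_valued T"

definition densely_defined :: "('h::complex_hilbert \<times> 'h) set \<Rightarrow> bool"
  where "densely_defined T \<longleftrightarrow> closure (Domain T) = UNIV"

definition positive_op :: "('h::complex_hilbert \<times> 'h) set \<Rightarrow> bool"
  where "positive_op T \<longleftrightarrow> (\<forall>(x, y)\<in>T. cinner y x \<in> \<real>\<^sub>\<ge>\<^sub>0)"

definition op_adjoint :: "('h::complex_hilbert \<times> 'h) set \<Rightarrow> ('h \<times> 'h) set"
  where "op_adjoint T = {(u, v). \<forall>(x, y)\<in>T. cinner y u = cinner x v}"

definition self_adjoint_op :: "('h::complex_hilbert \<times> 'h) set \<Rightarrow> bool"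
  where "self_adjoint_op T \<longleftrightarrow> unbounded_op T \<and> densely_defined T \<and> op_adjoint T = T"

definition null_space :: "('h::complex_hilbert \<Rightarrow> 'h) \<Rightarrow> 'h set"
  where "null_space A = {x. A x = 0}"

definition op_quotient ::
    "('h::complex_hilbert \<Rightarrow> 'h) \<Rightarrow> ('h \<Rightarrow> 'h) \<Rightarrow> ('h \<times> 'h) set"
  where "op_quotient A B = {(B x, A x) | x. True}"

definition aff :: "('h::complex_hilbert \<Rightarrow> 'h) set \<Rightarrow> ('h \<times> 'h) set set"
  where "aff M =
    {op_quotient A B | A B. A \<in> M \<and> B \<in> M \<and> null_space B \<subseteq> null_space A}"

text \<open>Only meaningful for \<open>T \<in> aff M\<close>; the description is then unique because the value does not
  depend on the representation of \<open>T\<close> as a quotient.\<close>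

definition aff_map ::
    "('h::complex_hilbert \<Rightarrow> 'h) set \<Rightarrow> (('h \<Rightarrow> 'h) \<Rightarrow> ('k::complex_hilbert \<Rightarrow> 'k))
      \<Rightarrow> ('h \<times> 'h) set \<Rightarrow> ('k \<times> 'k) set"
  where "aff_map M \<Phi> T =
    (THE R. \<exists>A\<in>M. \<exists>B\<in>M. null_space B \<subseteq> null_space A \<and>
       T = op_quotient A B \<and> R = op_quotient (\<Phi> A) (\<Phi> B))"

section \<open>Extremal positive self-adjoint extensions\<close>

text \<open>\<open>(T + I)\<^sup>-\<^sup>1\<close>, which is everywhere defined and bounded for positive self-adjoint \<open>T\<close>:
  the value at \<open>z\<close> is the \<open>x\<close> in the domain of \<open>T\<close> with \<open>T x = z - x\<close>.\<close>

definition inverse_plus_id :: "('h::complex_hilbert \<times> 'h) set \<Rightarrow> 'h \<Rightarrow> 'h"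
  where "inverse_plus_id T z = (THE x. (x, z - x) \<in> T)"

definition ext_le :: "('h::complex_hilbert \<times> 'h) set \<Rightarrow> ('h \<times> 'h) set \<Rightarrow> bool"
  where "ext_le T1 T2 \<longleftrightarrow> op_le (inverse_plus_id T2) (inverse_plus_id T1)"

definition psa_extensions :: "('h::complex_hilbert \<times> 'h) set \<Rightarrow> ('h \<times> 'h) set set"
  where "psa_extensions S = {T. self_adjoint_op T \<and> positive_op T \<and> S \<subseteq> T}"

definition krein_ext :: "('h::complex_hilbert \<times> 'h) set \<Rightarrow> ('h \<times> 'h) set"
  where "krein_ext S = (THE T. T \<in> psa_extensions S \<and> (\<forall>T'\<in>psa_extensions S. ext_le T T'))"

definition friedrichs_ext :: "('h::complex_hilbert \<times> 'h) set \<Rightarrow> ('h \<times> 'h) set"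
  where "friedrichs_ext S = (THE T. T \<in> psa_extensions S \<and> (\<forall>T'\<in>psa_extensions S. ext_le T' T))"

end

theory Submission
  imports Defs
begin

text \<open>A positive self-adjoint extension \<open>T\<close> of \<open>S\<close> is encoded by its resolvent
  \<open>R = (T + I)\<inverse>\<close>. Let \<open>P\<close> be the projection onto the closed range of \<open>S + I\<close> and let
  \<open>G = (S + I)\<inverse> P\<close>; both lie in \<open>M\<close>, by Douglas factorization. Then the extensions
  correspond, with the order reversed, to the operators \<open>0 \<le> R \<le> I\<close> with \<open>R P = G\<close>. With
  \<open>a = P G\<close>, the least such \<open>R\<close> is the strong limit of the increasing sequence
  \<open>\<Sum>k<n. G (I - a)\<^sup>k G*\<close>. A normal homomorphism maps this sequence to the sequence built from
  \<open>\<Phi> P\<close> and \<open>\<Phi> G\<close>, and preserves its limit, which settles the Friedrichs extension. The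
  Krein-von Neumann extension corresponds to the greatest \<open>R\<close>, which is \<open>I\<close> minus the least
  positive operator with \<open>R P = P - G\<close>.\<close>

section \<open>Hilbert space geometry\<close>

text \<open>The extremal extensions compete with all positive self-adjoint extensions, and on the
  target space these need not be images under \<open>\<Phi>\<close> of anything in \<open>M\<close>.
  Preservation of order is therefore not enough: the extremal resolvent has to be given by a formula
  in \<open>P\<close> and \<open>G\<close> that \<open>\<Phi>\<close> carries over. The formula
  comes from writing \<open>R\<close> as a two by two block matrix along the range of
  \<open>P\<close>. The condition \<open>R P = G\<close> fixes the first column, with entries a and
  b, hence by symmetry the first row, and positivity asks formally that the remaining corner
  dominate b inverse(a) adj(b). Equality there gives the least \<open>R\<close>. As a need not be
  invertible, the inverse is expanded in powers of I - a, and monotone convergence takes the place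
  of norm convergence. Passing from \<open>G\<close> to \<open>P - G\<close> stands for passing from
  \<open>S\<close> to its inverse, since \<open>S (S + I)\<inverse>\<close> is
  \<open>(S\<inverse> + I)\<inverse>\<close>. That inverse may be multivalued, but the bounded
  operators \<open>P\<close> and \<open>P - G\<close> always make sense. Positivity arguments rest
  on the Cauchy-Schwarz inequality for semidefinite forms instead of square roots.\<close>

lemma cinner_add_right: "cinner x (y + z) = cinner x y + cinner x z"
  for x :: "'h::complex_hilbert"
  by (metis cinner_add_left cinner_commute complex_cnj_add)

lemma cinner_scaleC_right: "cinner x (c *\<^sub>C y) = cnj c * cinner x y"
  for x :: "'h::complex_hilbert"
  by (metis cinner_commute cinner_scaleC_left complex_cnj_mult)

lemma scaleC_zero_left [simp]: "0 *\<^sub>C x = (0 :: 'h::complex_hilbert)"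
  by (metis add_cancel_right_left scaleC_add_left)

lemma scaleC_zero_right [simp]: "c *\<^sub>C 0 = (0 :: 'h::complex_hilbert)"
  by (metis add_cancel_right_left scaleC_add_right)

lemma scaleC_one [simp]: "1 *\<^sub>C x = (x :: 'h::complex_hilbert)"
  by (metis of_real_1 scaleR_one scaleR_scaleC)

lemma scaleC_minus1 [simp]: "(-1) *\<^sub>C x = - (x :: 'h::complex_hilbert)"
  by (metis of_real_1 of_real_minus scaleR_minus1_left scaleR_scaleC)

lemma scaleC_minus_right: "c *\<^sub>C (- x) = - (c *\<^sub>C (x :: 'h::complex_hilbert))"
  by (metis add.inverse_inverse add_eq_0_iff scaleC_add_right scaleC_zero_right)

lemma scaleC_diff_right: "c *\<^sub>C (x - y) = c *\<^sub>C x - c *\<^sub>C (y :: 'h::complex_hilbert)"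
  by (metis add_uminus_conv_diff scaleC_add_right scaleC_minus_right)

lemma cinner_zero_left [simp]: "cinner 0 (y :: 'h::complex_hilbert) = 0"
  by (metis add_cancel_right_left cinner_add_left)

lemma cinner_zero_right [simp]: "cinner (y :: 'h::complex_hilbert) 0 = 0"
  by (metis add_cancel_right_left cinner_add_right)

lemma cinner_minus_left: "cinner (- x) y = - cinner x (y :: 'h::complex_hilbert)"
  by (metis add_eq_0_iff cinner_add_left cinner_zero_left add.right_inverse)

lemma cinner_minus_right: "cinner x (- y) = - cinner x (y :: 'h::complex_hilbert)"
  by (metis add_eq_0_iff cinner_add_right cinner_zero_right add.right_inverse)

lemma cinner_diff_left: "cinner (x - y) z = cinner x z - cinner y (z :: 'h::complex_hilbert)"
  by (metis add_uminus_conv_diff cinner_add_left cinner_minus_left)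

lemma cinner_diff_right: "cinner x (y - z) = cinner x y - cinner x (z :: 'h::complex_hilbert)"
  by (metis add_uminus_conv_diff cinner_add_right cinner_minus_right)

lemmas cinner_simps = cinner_add_left cinner_add_right cinner_diff_left cinner_diff_right
  cinner_minus_left cinner_minus_right cinner_scaleC_left cinner_scaleC_right

lemma cinner_eq_zero_iff [simp]: "cinner x x = 0 \<longleftrightarrow> x = (0 :: 'h::complex_hilbert)"
  by (simp add: cinner_self)

lemma cinner_ext: "(\<And>z. cinner x z = cinner y z) \<Longrightarrow> x = (y :: 'h::complex_hilbert)"
  by (metis cinner_diff_left cinner_eq_zero_iff right_minus_eq)

lemma norm_scaleC: "norm (c *\<^sub>C x) = cmod c * norm (x :: 'h::complex_hilbert)"
proof -
  have "complex_of_real ((norm (c *\<^sub>C x))\<^sup>2) = c * cnj c * complex_of_real ((norm x)\<^sup>2)"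
    by (simp only: cinner_self [symmetric] cinner_simps mult_ac)
  also have "\<dots> = complex_of_real ((cmod c * norm x)\<^sup>2)"
    by (simp add: complex_norm_square [symmetric] power_mult_distrib del: of_real_power)
  finally show ?thesis
    by (metis abs_norm_cancel mult_nonneg_nonneg norm_ge_zero of_real_eq_iff power2_eq_iff_nonneg)
qed

lemma bounded_opsD:
  assumes "A \<in> bounded_ops"
  shows "A (x + y) = A x + A y" "A (c *\<^sub>C x) = c *\<^sub>C A x" "A (x - y) = A x - A y"
    "A (- x) = - A x" "A 0 = 0" "bounded_linear A"
  using assms linear_simps [of A] by (auto simp: bounded_ops_def)

lemma bounded_ops_tendsto:
  "A \<in> bounded_ops \<Longrightarrow> (f \<longlongrightarrow> l) F \<Longrightarrow> ((\<lambda>n. A (f n)) \<longlongrightarrow> A l) F"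
  by (rule bounded_linear.tendsto [OF bounded_opsD(6)])

lemma bounded_opsI:
  assumes "\<And>x y. A (x + y) = A x + A y" "\<And>c x. A (c *\<^sub>C x) = c *\<^sub>C A x"
    "\<And>x. norm (A x) \<le> norm x * K"
  shows "A \<in> bounded_ops"
  using assms by (auto simp: bounded_ops_def scaleR_scaleC intro!: bounded_linear_intro)

lemma bounded_ops_id: "id \<in> bounded_ops"
  by (rule bounded_opsI [where K = 1]) auto

text \<open>Over complex scalars a nonnegative quadratic form forces symmetry, so
  \<open>psd_op_symmetric\<close> is a consequence of this definition.\<close>

definition psd_op :: "('h::complex_hilbert \<Rightarrow> 'h) \<Rightarrow> bool"
  where "psd_op D \<longleftrightarrow> D \<in> bounded_ops \<and> (\<forall>x. cinner (D x) x \<in> \<real>\<^sub>\<ge>\<^sub>0)"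

text \<open>Polarization: reality of the form at \<open>x + y\<close> compares the imaginary parts
  of \<open>cinner (D x) y\<close> and \<open>cinner (D y) x\<close>, and reality at
  \<open>x + \<i> *\<^sub>C y\<close> compares their real parts.\<close>

lemma real_form_symmetric:
  fixes D :: "'h::complex_hilbert \<Rightarrow> 'h"
  assumes D: "D \<in> bounded_ops" and re: "\<And>x. cinner (D x) x \<in> \<real>"
  shows "cinner (D x) y = cinner x (D y)"
proof -
  have 1: "Im (cinner (D x) y) + Im (cinner (D y) x) = 0"
    using re [of "x + y"] re [of x] re [of y]
    by (simp add: bounded_opsD [OF D] cinner_simps complex_is_Real_iff)
  have 2: "Re (cinner (D y) x) = Re (cinner (D x) y)"
    using re [of "x + \<i> *\<^sub>C y"] re [of x] re [of y]
    by (simp add: bounded_opsD [OF D] cinner_simps complex_is_Real_iff)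
  have "cinner (D x) y = cnj (cinner (D y) x)"
    using 1 2 by (simp add: complex_eq_iff)
  then show ?thesis by (metis cinner_commute)
qed

lemma psd_op_symmetric:
  "psd_op D \<Longrightarrow> cinner (D x) y = cinner x (D y)"
  unfolding psd_op_def by (blast intro: real_form_symmetric nonneg_Reals_Real)

text \<open>The form of \<open>D\<close> is nonnegative along the line of points
  \<open>x - c *\<^sub>C y\<close>, and the best point on it gives the bound. Two instances recur:
  \<open>D = id\<close> is the usual inequality, and \<open>y = D x\<close> turns statements about
  the form into statements about the vector \<open>D x\<close>.\<close>

lemma psd_op_Cauchy_Schwarz:
  fixes D :: "'h::complex_hilbert \<Rightarrow> 'h"
  assumes "psd_op D"
  shows "(cmod (cinner (D x) y))\<^sup>2 \<le> Re (cinner (D x) x) * Re (cinner (D y) y)"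
proof -
  define b where "b = cinner (D x) y"
  define p where "p = Re (cinner (D x) x)"
  define q where "q = Re (cinner (D y) y)"
  have D: "D \<in> bounded_ops" and re: "\<And>x. Re (cinner (D x) x) \<ge> 0"
    using assms by (auto simp: psd_op_def complex_nonneg_Reals_iff)
  have b': "cinner (D y) x = cnj b"
    unfolding b_def by (metis assms cinner_commute psd_op_symmetric)
  \<comment> \<open>Giving \<open>c\<close> the phase of \<open>b\<close> makes both cross terms
    real and leaves a real quadratic in \<open>t\<close>.\<close>
  have *: "0 \<le> p - 2 * t * (cmod b)\<^sup>2 + t\<^sup>2 * (cmod b)\<^sup>2 * q" for t :: real
  proof -
    define c where "c = complex_of_real t * b"
    have "cinner (D (x - c *\<^sub>C y)) (x - c *\<^sub>C y)
      = cinner (D x) x - cnj c * b - c * cnj b + c * cnj c * cinner (D y) y"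
      by (simp add: bounded_opsD [OF D] cinner_simps b' b_def algebra_simps)
    moreover have "cnj c * b = complex_of_real (t * (cmod b)\<^sup>2)" "c * cnj b = complex_of_real (t * (cmod b)\<^sup>2)"
      "c * cnj c = complex_of_real (t\<^sup>2 * (cmod b)\<^sup>2)"
      by (simp_all only: c_def of_real_mult complex_norm_square power2_eq_square [of t] complex_cnj_mult complex_cnj_complex_of_real mult_ac)
    ultimately have "cinner (D (x - c *\<^sub>C y)) (x - c *\<^sub>C y)
      = cinner (D x) x - complex_of_real (2 * t * (cmod b)\<^sup>2) + complex_of_real (t\<^sup>2 * (cmod b)\<^sup>2) * cinner (D y) y"
      by simp
    with re [of "x - c *\<^sub>C y"] show ?thesis
      by (simp add: p_def q_def del: of_real_mult of_real_power)
  qed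
  have q0: "q \<ge> 0" and p0: "p \<ge> 0" using re by (simp_all add: q_def p_def)
  have "(cmod b)\<^sup>2 \<le> p * q"
  proof (cases "q = 0")
    case True
    have "(cmod b)\<^sup>2 = 0"
    proof (rule ccontr)
      assume "(cmod b)\<^sup>2 \<noteq> 0"
      \<comment> \<open>For \<open>q = 0\<close> the quadratic is linear in \<open>t\<close>, and
        this \<open>t\<close> gives it the value \<open>- p - 2\<close>.\<close>
      then show False
        using * [of "(p + 1) / (cmod b)\<^sup>2"] True p0 by simp
    qed
    with True show ?thesis by simp
  next
    case False
    with q0 have "q > 0" by simp
    \<comment> \<open>\<open>t = 1 / q\<close> minimizes the quadratic.\<close>
    have "0 \<le> p - (cmod b)\<^sup>2 / q"
      using * [of "1 / q"] \<open>q > 0\<close> by (simp add: power2_eq_square)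
    with \<open>q > 0\<close> show ?thesis by (simp add: field_simps)
  qed
  then show ?thesis by (simp add: b_def p_def q_def)
qed

lemma psd_op_id: "psd_op id"
  by (simp add: psd_op_def bounded_ops_id cinner_self del: of_real_power)

lemma Re_cinner_self: "Re (cinner x x) = (norm (x :: 'h::complex_hilbert))\<^sup>2"
  by (simp add: cinner_self del: of_real_power)

lemma Cauchy_Schwarz: "cmod (cinner x y) \<le> norm x * norm (y :: 'h::complex_hilbert)"
  using psd_op_Cauchy_Schwarz [OF psd_op_id, of x y]
  by (simp add: Re_cinner_self power_mult_distrib [symmetric] abs_le_square_iff [symmetric])

lemma bounded_bilinear_cinner:
  "bounded_bilinear (cinner :: 'h::complex_hilbert \<Rightarrow> _)"
  by standard (auto simp: cinner_simps scaleR_scaleC [where 'a = 'h] scaleR_conv_of_real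
      intro!: exI [of _ 1] Cauchy_Schwarz)

lemmas tendsto_cinner = bounded_bilinear.tendsto [OF bounded_bilinear_cinner]
lemmas continuous_on_cinner = bounded_bilinear.continuous_on [OF bounded_bilinear_cinner]

lemma cinner_sum_left: "cinner (\<Sum>i\<in>I. f i) y = (\<Sum>i\<in>I. cinner (f i) (y :: 'h::complex_hilbert))"
  by (rule bounded_bilinear.sum_left [OF bounded_bilinear_cinner])

lemma parallelogram:
  "(norm (x + y))\<^sup>2 + (norm (x - y))\<^sup>2 = 2 * (norm x)\<^sup>2 + 2 * (norm (y :: 'h::complex_hilbert))\<^sup>2"
  by (simp add: Re_cinner_self [symmetric] cinner_simps)

section \<open>Orthogonal projection onto closed subspaces\<close>

definition csubspace :: "'h::complex_hilbert set \<Rightarrow> bool"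
  where "csubspace L \<longleftrightarrow> 0 \<in> L \<and> (\<forall>x\<in>L. \<forall>y\<in>L. x + y \<in> L) \<and> (\<forall>c. \<forall>x\<in>L. c *\<^sub>C x \<in> L)"

lemma csubspace_diff: "csubspace L \<Longrightarrow> x \<in> L \<Longrightarrow> y \<in> L \<Longrightarrow> x - y \<in> L"
  unfolding csubspace_def by (metis add_uminus_conv_diff scaleC_minus1)

lemma csubspace_range: "A \<in> bounded_ops \<Longrightarrow> csubspace (range A)"
  unfolding csubspace_def
  by (auto simp: bounded_opsD(1,2) [symmetric]) (metis bounded_opsD(5) rangeI)

lemma csubspace_closure:
  assumes "csubspace L" shows "csubspace (closure L)"
  unfolding csubspace_def
proof (intro conjI ballI allI)
  show "0 \<in> closure L" using assms closure_subset by (auto simp: csubspace_def)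
next
  fix x y assume "x \<in> closure L" "y \<in> closure L"
  then obtain f g where "\<And>n. f n \<in> L" "f \<longlonglongrightarrow> x" "\<And>n. g n \<in> L" "g \<longlonglongrightarrow> y"
    by (auto simp: closure_sequential)
  then show "x + y \<in> closure L"
    using assms by (auto simp: closure_sequential csubspace_def intro!: exI [of _ "\<lambda>n. f n + g n"] tendsto_add)
next
  fix c x assume "x \<in> closure L"
  then obtain f where f: "\<And>n. f n \<in> L" "f \<longlonglongrightarrow> x"
    by (auto simp: closure_sequential)
  have "(\<lambda>x :: 'a. c *\<^sub>C x) \<in> bounded_ops"
    by (rule bounded_opsI [where K = "cmod c"])
      (auto simp: scaleC_add_right scaleC_scaleC norm_scaleC mult.commute)
  then have "(\<lambda>n. c *\<^sub>C f n) \<longlonglongrightarrow> c *\<^sub>C x"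
    using f(2) by (rule bounded_ops_tendsto)
  moreover have "c *\<^sub>C f n \<in> L" for n
    using f(1) assms by (simp add: csubspace_def)
  ultimately show "c *\<^sub>C x \<in> closure L"
    unfolding closure_sequential by (intro exI [of _ "\<lambda>n. c *\<^sub>C f n"]) simp
qed

lemma minimal_distance_orthogonal:
  fixes y :: "'h::complex_hilbert"
  assumes "csubspace L" and "\<And>l. l \<in> L \<Longrightarrow> norm y \<le> norm (y - l)" and l: "l \<in> L"
  shows "cinner y l = 0"
proof (rule ccontr)
  define b where "b = cinner y l"
  \<comment> \<open>Replacing \<open>y\<close> by \<open>y - c *\<^sub>C l\<close> changes the
    squared norm by \<open>|b|^2 * (t^2 * |l|^2 - 2 * t)\<close>. This choice keeps
    \<open>t * |l|^2\<close> below 1, so the vector would become shorter.\<close>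
  define t where "t = 1 / ((norm l)\<^sup>2 + 1)"
  define c where "c = complex_of_real t * b"
  assume "cinner y l \<noteq> 0"
  then have b: "cmod b > 0" by (simp add: b_def)
  have t: "t > 0" unfolding t_def by (simp add: add_nonneg_pos)
  have "(norm y)\<^sup>2 \<le> (norm (y - c *\<^sub>C l))\<^sup>2"
    using assms by (intro power_mono) (auto simp: csubspace_def)
  also have "\<dots> = (norm y)\<^sup>2 - Re (cnj c * b) - Re (c * cnj b) + Re (c * cnj c) * (norm l)\<^sup>2"
  proof -
    have "cinner l y = cnj b" unfolding b_def by (rule cinner_commute)
    then have "cinner (y - c *\<^sub>C l) (y - c *\<^sub>C l)
      = cinner y y - cnj c * b - c * cnj b + c * cnj c * complex_of_real ((norm l)\<^sup>2)"
      by (simp only: cinner_simps b_def cinner_self [of l, symmetric]) (simp add: algebra_simps)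
    then show ?thesis by (simp add: Re_cinner_self [symmetric] complex_mult_cnj del: of_real_power)
  qed
  also have "cnj c * b = complex_of_real (t * (cmod b)\<^sup>2)"
    by (simp only: c_def of_real_mult complex_norm_square power2_eq_square [of t] complex_cnj_mult complex_cnj_complex_of_real mult_ac)
  also have "c * cnj b = complex_of_real (t * (cmod b)\<^sup>2)"
    by (simp only: c_def of_real_mult complex_norm_square power2_eq_square [of t] complex_cnj_mult complex_cnj_complex_of_real mult_ac)
  also have "c * cnj c = complex_of_real (t\<^sup>2 * (cmod b)\<^sup>2)"
    by (simp only: c_def of_real_mult complex_norm_square power2_eq_square [of t] complex_cnj_mult complex_cnj_complex_of_real mult_ac)
  finally have "2 * t * (cmod b)\<^sup>2 \<le> t\<^sup>2 * (cmod b)\<^sup>2 * (norm l)\<^sup>2"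
    by (simp del: of_real_mult of_real_power)
  then have "t * (cmod b)\<^sup>2 * 2 \<le> t * (cmod b)\<^sup>2 * (t * (norm l)\<^sup>2)"
    by (simp add: power2_eq_square algebra_simps)
  then have "2 \<le> t * (norm l)\<^sup>2"
    using t b by (subst (asm) mult_le_cancel_left_pos) auto
  moreover have "t * (norm l)\<^sup>2 \<le> 1"
    unfolding t_def by (simp add: divide_le_eq_1 add_nonneg_pos)
  ultimately show False by simp
qed

text \<open>The point \<open>p\<close> is the limit of a sequence in \<open>L\<close> that minimizes
  the distance to \<open>x\<close>. Midpoints of the sequence stay in \<open>L\<close>, so the
  parallelogram law bounds \<open>norm (f m - f n)\<close> by the excess of the two squared
  distances over the minimum, and the sequence is Cauchy.\<close>

lemma projection_theorem:
  fixes L :: "'h::complex_hilbert set"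
  assumes L: "csubspace L" and "closed L"
  obtains p where "p \<in> L" "\<And>l. l \<in> L \<Longrightarrow> cinner (x - p) l = 0"
proof -
  define d where "d = infdist x L"
  have ne: "L \<noteq> {}" using L by (auto simp: csubspace_def)
  have d_le: "d \<le> norm (x - l)" if "l \<in> L" for l
    unfolding d_def using infdist_le [OF that, of x] by (simp add: dist_norm)
  have d0: "d \<ge> 0" by (simp add: d_def infdist_nonneg)
  have "\<exists>l\<in>L. norm (x - l) < d + inverse (real (Suc n))" for n
  proof -
    have "(INF a\<in>L. dist x a) < d + inverse (real (Suc n))"
      using ne by (simp add: d_def infdist_def del: of_nat_Suc)
    then show ?thesis
      using cInf_lessD [of "dist x ` L"] ne by (auto simp: dist_norm)
  qed
  then obtain f where f: "\<And>n. f n \<in> L" "\<And>n. norm (x - f n) < d + inverse (real (Suc n))"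
    by metis
  have lim: "(\<lambda>n. norm (x - f n)) \<longlonglongrightarrow> d"
  proof (rule tendsto_sandwich [of "\<lambda>_. d" _ _ "\<lambda>n. d + inverse (real (Suc n))"])
    show "(\<lambda>n. d + inverse (real (Suc n))) \<longlonglongrightarrow> d"
      using tendsto_add [OF tendsto_const LIMSEQ_inverse_real_of_nat, of d] by simp
    show "\<forall>\<^sub>F n in sequentially. norm (x - f n) \<le> d + inverse (real (Suc n))"
      using f(2) by (intro always_eventually) (auto intro: less_imp_le simp del: of_nat_Suc)
  qed (use f d_le in auto)
  have par: "(norm (f m - f n))\<^sup>2 \<le> 2 * ((norm (x - f m))\<^sup>2 - d\<^sup>2) + 2 * ((norm (x - f n))\<^sup>2 - d\<^sup>2)" for m n
  proof -
    have "(1/2) *\<^sub>C (f m + f n) \<in> L" using L f by (auto simp: csubspace_def)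
    then have "2 * d \<le> 2 * norm (x - (1/2) *\<^sub>C (f m + f n))" using d_le by simp
    also have "\<dots> = norm (2 *\<^sub>C (x - (1/2) *\<^sub>C (f m + f n)))" by (simp add: norm_scaleC)
    also have "2 *\<^sub>C (x - (1/2) *\<^sub>C (f m + f n)) = (x - f m) + (x - f n)"
      using scaleC_add_left [of 1 1 x]
      by (simp add: scaleC_diff_right scaleC_scaleC)
    finally have "(2 * d)\<^sup>2 \<le> (norm ((x - f m) + (x - f n)))\<^sup>2"
      using d0 by (intro power_mono) auto
    with parallelogram [of "x - f m" "x - f n"] show ?thesis
      by (simp add: power_mult_distrib norm_minus_commute)
  qed
  have "Cauchy f"
  proof (rule metric_CauchyI)
    fix e :: real assume "e > 0"
    have "(\<lambda>n. (norm (x - f n))\<^sup>2 - d\<^sup>2) \<longlonglongrightarrow> d\<^sup>2 - d\<^sup>2" by (intro tendsto_intros lim)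
    then have "\<forall>\<^sub>F n in sequentially. (norm (x - f n))\<^sup>2 - d\<^sup>2 < e\<^sup>2 / 4"
      by (rule order_tendstoD) (use \<open>e > 0\<close> in simp)
    then obtain k where k: "\<And>n. n \<ge> k \<Longrightarrow> (norm (x - f n))\<^sup>2 - d\<^sup>2 < e\<^sup>2 / 4"
      by (auto simp: eventually_sequentially)
    have "dist (f m) (f n) < e" if "m \<ge> k" "n \<ge> k" for m n
    proof -
      have "(norm (f m - f n))\<^sup>2 < e\<^sup>2"
        using par [of m n] k [OF that(1)] k [OF that(2)] by argo
      then show ?thesis
        using \<open>e > 0\<close> by (simp add: dist_norm power2_less_imp_less)
    qed
    then show "\<exists>k. \<forall>m\<ge>k. \<forall>n\<ge>k. dist (f m) (f n) < e" by blast
  qed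
  then obtain p where p: "f \<longlonglongrightarrow> p" using Cauchy_convergent convergentD by blast
  then have "p \<in> L" using \<open>closed L\<close> f by (metis closed_sequential_limits)
  have "norm (x - p) = d"
    using LIMSEQ_unique [OF lim tendsto_norm [OF tendsto_diff [OF tendsto_const p]]] by simp
  moreover have "p + l \<in> L" if "l \<in> L" for l
    using that L \<open>p \<in> L\<close> by (simp add: csubspace_def)
  ultimately have "cinner (x - p) l = 0" if "l \<in> L" for l
    by (intro minimal_distance_orthogonal [OF L _ that]) (use d_le in \<open>auto simp: diff_diff_eq\<close>)
  with \<open>p \<in> L\<close> show ?thesis by (rule that)
qed

lemma dense_of_orthogonal:
  fixes L :: "'h::complex_hilbert set"
  assumes "csubspace L" and "\<And>z. (\<And>l. l \<in> L \<Longrightarrow> cinner z l = 0) \<Longrightarrow> z = 0"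
  shows "closure L = UNIV"
proof -
  have "x \<in> closure L" for x
  proof (rule projection_theorem [OF csubspace_closure [OF assms(1)] closed_closure])
    fix p assume p: "p \<in> closure L" "\<And>l. l \<in> closure L \<Longrightarrow> cinner (x - p) l = 0"
    have "x - p = 0" using closure_subset p(2) by (intro assms(2)) blast
    then show ?thesis using p by simp
  qed
  then show ?thesis by blast
qed

lemma orthogonal_dense:
  fixes z :: "'h::complex_hilbert"
  assumes "closure L = UNIV" and "\<And>l. l \<in> L \<Longrightarrow> cinner z l = 0"
  shows "z = 0"
proof -
  have "z \<in> closure L" using assms by simp
  then obtain f where "\<And>n. f n \<in> L" "f \<longlonglongrightarrow> z" by (auto simp: closure_sequential)
  then have "(\<lambda>n. cinner z (f n)) \<longlonglongrightarrow> cinner z z" by (intro tendsto_cinner tendsto_const)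
  then have "(\<lambda>n. 0) \<longlonglongrightarrow> cinner z z" using assms \<open>\<And>n. f n \<in> L\<close> by simp
  then show "z = 0" by (simp add: LIMSEQ_const_iff)
qed

section \<open>Adjoints\<close>

lemma Riesz_representation:
  fixes f :: "'h::complex_hilbert \<Rightarrow> complex"
  assumes f: "bounded_linear f" "\<And>c x. f (c *\<^sub>C x) = c * f x"
  obtains v where "\<And>x. f x = cinner x v"
proof (cases "\<forall>x. f x = 0")
  case True
  then show ?thesis using that [of 0] by simp
next
  case False
  note lin = linear_simps [OF f(1)]
  then obtain x where x: "f x \<noteq> 0" using False by blast
  let ?L = "{x. f x = 0}"
  have "csubspace ?L" using f(2) by (auto simp: csubspace_def lin)
  moreover have "closed ?L"
    by (intro closed_Collect_eq continuous_on_const linear_continuous_on f(1))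
  ultimately obtain p where p: "f p = 0" "\<And>l. f l = 0 \<Longrightarrow> cinner (x - p) l = 0"
    using projection_theorem [of ?L x] by auto
  define w where "w = x - p"
  have w: "f w \<noteq> 0" using x p by (simp add: w_def lin)
  then have "w \<noteq> 0" using lin by auto
  have "f y = cinner y ((cnj (f w) / complex_of_real ((norm w)\<^sup>2)) *\<^sub>C w)" for y
  proof -
    \<comment> \<open>This combination of \<open>y\<close> and \<open>w\<close> lies in the kernel
      of \<open>f\<close>, to which \<open>w\<close> is orthogonal; pairing it with \<open>w\<close>
      solves for \<open>f y\<close>.\<close>
    have "f (f w *\<^sub>C y - f y *\<^sub>C w) = 0" by (simp add: lin f(2))
    then have "cinner (f w *\<^sub>C y - f y *\<^sub>C w) w = 0"
      using p(2) unfolding w_def by (metis cinner_commute complex_cnj_zero)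
    then have "f w * cinner y w = f y * complex_of_real ((norm w)\<^sup>2)"
      by (simp add: cinner_simps cinner_self)
    then show ?thesis using \<open>w \<noteq> 0\<close> by (simp add: cinner_simps field_simps)
  qed
  then show ?thesis by (rule that)
qed

text \<open>Discharges the definite description in \<open>adj\<close>: existence is Riesz
  representation of \<open>\<lambda>x. cinner (A x) y\<close>, uniqueness is nondegeneracy of the
  inner product.\<close>

lemma cinner_adj:
  fixes A :: "'h::complex_hilbert \<Rightarrow> 'h"
  assumes A: "A \<in> bounded_ops"
  shows "cinner (A x) y = cinner x (adj A y)"
proof -
  have "\<exists>v. \<forall>x. cinner (A x) y = cinner x v" for y
  proof -
    have "bounded_linear (\<lambda>x. cinner (A x) y)"
      by (rule bounded_linear_compose [OF bounded_bilinear.bounded_linear_left [OF bounded_bilinear_cinner] bounded_opsD(6) [OF A]])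
    then show ?thesis
      by (rule Riesz_representation) (auto simp: bounded_opsD [OF A] cinner_simps)
  qed
  then obtain B where B: "\<forall>x y. cinner (A x) y = cinner x (B y)" by metis
  have "\<forall>x y. cinner (A x) y = cinner x (adj A y)"
    unfolding adj_def
  proof (rule theI [where P = "\<lambda>B. \<forall>x y. cinner (A x) y = cinner x (B y)", OF B])
    fix B' assume "\<forall>x y. cinner (A x) y = cinner x (B' y)"
    with B have "cinner (B' y) x = cinner (B y) x" for x y by (metis cinner_commute)
    then show "B' = B" by (blast intro: cinner_ext)
  qed
  then show ?thesis by blast
qed

lemma cinner_adj': "A \<in> bounded_ops \<Longrightarrow> cinner (adj A x) y = cinner x (A y)"
  by (metis cinner_adj cinner_commute)

lemma adj_eqI:
  fixes A :: "'h::complex_hilbert \<Rightarrow> 'h"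
  assumes "A \<in> bounded_ops" and "\<And>x y. cinner (A x) y = cinner x (B y)"
  shows "adj A = B"
proof
  fix y
  show "adj A y = B y"
    by (rule cinner_ext) (metis assms cinner_adj' cinner_commute)
qed

lemma bounded_ops_adj:
  fixes A :: "'h::complex_hilbert \<Rightarrow> 'h"
  assumes A: "A \<in> bounded_ops"
  shows "adj A \<in> bounded_ops"
proof -
  obtain K where K: "\<And>x. norm (A x) \<le> norm x * K" "K \<ge> 0"
    using bounded_linear.nonneg_bounded [OF bounded_opsD(6) [OF A]] by blast
  show ?thesis
  proof (rule bounded_opsI [where K = K])
    show "adj A (x + y) = adj A x + adj A y" for x y
      by (rule cinner_ext) (simp add: cinner_adj' [OF A] cinner_simps)
    show "adj A (c *\<^sub>C x) = c *\<^sub>C adj A x" for c x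
      by (rule cinner_ext) (simp add: cinner_adj' [OF A] cinner_simps)
    fix x
    have "(norm (adj A x))\<^sup>2 = Re (cinner x (A (adj A x)))"
      by (metis Re_cinner_self cinner_adj' [OF A])
    also have "\<dots> \<le> norm x * norm (A (adj A x))"
      by (meson Cauchy_Schwarz complex_Re_le_cmod order_trans)
    also have "\<dots> \<le> norm x * (norm (adj A x) * K)"
      by (intro mult_left_mono K) auto
    finally have "norm (adj A x) * norm (adj A x) \<le> norm (adj A x) * (norm x * K)"
      by (simp add: power2_eq_square mult_ac)
    then show "norm (adj A x) \<le> norm x * K"
      using K(2) by (cases "norm (adj A x) = 0") (auto simp: mult_le_cancel_left)
  qed
qed

lemma adj_self_iff:
  "A \<in> bounded_ops \<Longrightarrow> adj A = A \<longleftrightarrow> (\<forall>x y. cinner (A x) y = cinner x (A y))"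
  by (metis adj_eqI cinner_adj)

section \<open>Monotone sequences of operators\<close>

lemma bounded_ops_comp:
  "A \<in> bounded_ops \<Longrightarrow> B \<in> bounded_ops \<Longrightarrow> (\<lambda>x. A (B x)) \<in> bounded_ops"
  by (auto simp: bounded_ops_def intro: bounded_linear_compose)

lemma bounded_ops_add:
  "A \<in> bounded_ops \<Longrightarrow> B \<in> bounded_ops \<Longrightarrow> (\<lambda>x. A x + B x) \<in> bounded_ops"
  by (auto simp: bounded_ops_def scaleC_add_right intro: bounded_linear_add)

lemma bounded_ops_diff:
  "A \<in> bounded_ops \<Longrightarrow> B \<in> bounded_ops \<Longrightarrow> (\<lambda>x. A x - B x) \<in> bounded_ops"
  by (auto simp: bounded_ops_def scaleC_diff_right intro: bounded_linear_sub)

lemma bounded_ops_scaleC: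
  fixes A :: "'h::complex_hilbert \<Rightarrow> 'h"
  assumes "A \<in> bounded_ops"
  shows "(\<lambda>x. c *\<^sub>C A x) \<in> bounded_ops"
proof -
  have "(\<lambda>x :: 'h. c *\<^sub>C x) \<in> bounded_ops"
    by (rule bounded_opsI [where K = "cmod c"])
      (auto simp: scaleC_add_right scaleC_scaleC norm_scaleC mult.commute)
  then show ?thesis using assms by (rule bounded_ops_comp)
qed

lemma bounded_ops_ident: "(\<lambda>x. x) \<in> bounded_ops"
  using bounded_ops_id by (simp add: id_def)

lemma bounded_ops_zero: "(\<lambda>x. 0) \<in> bounded_ops"
  by (rule bounded_opsI [where K = 0]) auto

lemma bounded_ops_funpow: "A \<in> bounded_ops \<Longrightarrow> A ^^ n \<in> bounded_ops"
  by (induction n) (auto simp: bounded_ops_id bounded_ops_comp o_def)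

lemma bounded_ops_sum:
  assumes "\<And>i. i \<in> I \<Longrightarrow> A i \<in> bounded_ops"
  shows "(\<lambda>x. \<Sum>i\<in>I. A i x) \<in> bounded_ops"
proof (cases "finite I")
  case True
  then show ?thesis using assms
    by (induction I) (auto simp: bounded_ops_zero bounded_ops_add)
qed (simp add: bounded_ops_zero)

lemmas bounded_ops_intros = bounded_ops_add bounded_ops_diff bounded_ops_scaleC
  bounded_ops_id bounded_ops_ident bounded_ops_zero bounded_ops_funpow bounded_ops_sum bounded_ops_adj

lemma bounded_ops_bound:
  assumes "A \<in> bounded_ops"
  obtains K where "K > 0" "\<And>x. norm (A x) \<le> K * norm x"
  using bounded_linear.pos_bounded [OF bounded_opsD(6) [OF assms]] by (auto simp: mult.commute)

lemma op_le_refl: "op_le A A"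
  by (simp add: op_le_def)

lemma op_le_trans:
  assumes "op_le A B" "op_le B C" shows "op_le A C"
  unfolding op_le_def
proof
  fix x
  have "cinner (C x - A x) x = cinner (C x - B x) x + cinner (B x - A x) x"
    by (simp add: cinner_simps)
  then show "cinner (C x - A x) x \<in> \<real>\<^sub>\<ge>\<^sub>0"
    using assms by (simp add: op_le_def)
qed

lemma op_le_mono_seq:
  fixes T :: "nat \<Rightarrow> 'h::complex_hilbert \<Rightarrow> 'h"
  assumes "\<And>n. op_le (T n) (T (Suc n))" "m \<le> n"
  shows "op_le (T m) (T n)"
  using assms(2) by (induction rule: dec_induct) (auto intro: op_le_refl op_le_trans assms(1))

text \<open>The form of \<open>B - A\<close> vanishes identically, and Cauchy-Schwarz for this form,
  with its own value as second argument, makes the operator vanish.\<close>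

lemma op_le_antisym:
  assumes "op_le A B" "op_le B A" "A \<in> bounded_ops" "B \<in> bounded_ops"
  shows "A = B"
proof
  fix x
  let ?D = "\<lambda>x. B x - A x"
  have D: "psd_op ?D" using assms by (simp add: psd_op_def op_le_def bounded_ops_diff)
  have "Re (cinner (B x - A x) x) \<le> 0" for x
    using assms(2) by (simp add: op_le_def complex_nonneg_Reals_iff cinner_simps)
  moreover have "Re (cinner (B x - A x) x) \<ge> 0" for x
    using assms(1) by (simp add: op_le_def complex_nonneg_Reals_iff)
  ultimately have "Re (cinner (B x - A x) x) = 0" for x by (simp add: order_antisym)
  then have "cinner (?D x) (?D x) = 0"
    using psd_op_Cauchy_Schwarz [OF D, of x "?D x"] by simp
  then show "A x = B x" by simp
qed

text \<open>In operator terms, \<open>0 \<le> D \<le> K\<close> implies that the square of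
  \<open>D\<close> is at most \<open>K D\<close>. Cauchy-Schwarz for the form of \<open>D\<close> at
  \<open>x\<close> and \<open>D x\<close> gives this after one factor
  \<open>(norm (D x))\<^sup>2\<close> is cancelled. It upgrades convergence of quadratic forms to
  convergence of vectors.\<close>

lemma psd_op_norm_le:
  assumes D: "psd_op D" and "\<And>x. Re (cinner (D x) x) \<le> K * (norm x)\<^sup>2"
  shows "(norm (D x))\<^sup>2 \<le> K * Re (cinner (D x) x)"
proof -
  have p: "Re (cinner (D x) x) \<ge> 0"
    using D by (simp add: psd_op_def complex_nonneg_Reals_iff)
  have "((norm (D x))\<^sup>2)\<^sup>2 \<le> Re (cinner (D x) x) * Re (cinner (D (D x)) (D x))"
    using psd_op_Cauchy_Schwarz [OF D, of x "D x"]
    by (simp add: cinner_self norm_power del: of_real_power)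
  also have "\<dots> \<le> Re (cinner (D x) x) * (K * (norm (D x))\<^sup>2)"
    by (intro mult_left_mono assms p)
  finally have *: "(norm (D x))\<^sup>2 * (norm (D x))\<^sup>2 \<le> (norm (D x))\<^sup>2 * (K * Re (cinner (D x) x))"
    by (simp add: power2_eq_square mult_ac)
  show ?thesis
  proof (cases "D x = 0")
    case False
    then have "(norm (D x))\<^sup>2 > 0" by simp
    with * show ?thesis by (simp only: mult_le_cancel_left_pos)
  qed simp
qed

text \<open>The numbers \<open>Re (cinner (T n x) x)\<close> increase and are bounded, hence
  converge. Applying \<open>psd_op_norm_le\<close> to the differences \<open>T n - T m\<close>, all
  dominated by \<open>U - T 0\<close>, makes the vectors \<open>T n x\<close> a Cauchy
  sequence.\<close>

lemma monotone_strong_limit: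
  fixes T :: "nat \<Rightarrow> 'h::complex_hilbert \<Rightarrow> 'h"
  assumes T: "\<And>n. T n \<in> bounded_ops" and inc: "\<And>n. op_le (T n) (T (Suc n))"
    and U: "U \<in> bounded_ops" and le: "\<And>n. op_le (T n) U"
  obtains L where "L \<in> bounded_ops" "\<And>x. (\<lambda>n. T n x) \<longlonglongrightarrow> L x"
proof -
  obtain K where K: "K > 0" "\<And>x. norm (U x - T 0 x) \<le> K * norm x"
    using bounded_ops_bound [OF bounded_ops_diff [OF U T]] by metis
  have bnd: "Re (cinner (U x - T 0 x) x) \<le> K * (norm x)\<^sup>2" for x
  proof -
    have "Re (cinner (U x - T 0 x) x) \<le> norm (U x - T 0 x) * norm x"
      by (meson Cauchy_Schwarz complex_Re_le_cmod order_trans)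
    also have "\<dots> \<le> K * norm x * norm x" by (intro mult_right_mono K) auto
    finally show ?thesis by (simp add: power2_eq_square)
  qed
  have leRe: "Re (cinner (A x) x) \<le> Re (cinner (B x) x)" if "op_le A B" for A B :: "'h \<Rightarrow> 'h" and x
    using that by (simp add: op_le_def complex_nonneg_Reals_iff cinner_simps)
  have mono: "op_le (T m) (T n)" if "m \<le> n" for m n
    using inc that by (rule op_le_mono_seq)
  have diff: "(norm (T n x - T m x))\<^sup>2 \<le> K * Re (cinner (T n x - T m x) x)" if "m \<le> n" for m n x
  proof (rule psd_op_norm_le [where D = "\<lambda>x. T n x - T m x"])
    show "psd_op (\<lambda>x. T n x - T m x)"
      using mono [OF that] T by (simp add: psd_op_def op_le_def bounded_ops_diff)
    fix x
    show "Re (cinner (T n x - T m x) x) \<le> K * (norm x)\<^sup>2"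
      using bnd [of x] leRe [OF le [of n], of x] leRe [OF mono [of 0 m], of x]
      by (simp add: cinner_simps)
  qed
  have "Cauchy (\<lambda>n. T n x)" for x
  proof -
    let ?r = "\<lambda>n. Re (cinner (T n x) x)"
    have "norm (?r n) \<le> \<bar>?r 0\<bar> + \<bar>Re (cinner (U x) x)\<bar>" for n
      using leRe [OF le [of n], of x] leRe [OF mono [of 0 n], of x] by simp
    then have "Bseq ?r" by (rule BseqI')
    moreover have "\<forall>m n. m \<le> n \<longrightarrow> ?r m \<le> ?r n" using leRe [OF mono] by blast
    ultimately have "convergent ?r" by (intro Bseq_mono_convergent) auto
    then have C: "Cauchy ?r" by (rule convergent_Cauchy)
    show ?thesis
    proof (rule metric_CauchyI)
      fix e :: real assume "e > 0"
      then have "e\<^sup>2 / K > 0" using K by simp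
      then obtain k where k: "\<And>m n. m \<ge> k \<Longrightarrow> n \<ge> k \<Longrightarrow> dist (?r m) (?r n) < e\<^sup>2 / K"
        using metric_CauchyD [OF C] by metis
      have *: "dist (T n x) (T m x) < e" if "m \<ge> k" "m \<le> n" for m n
      proof -
        have "Re (cinner (T n x - T m x) x) < e\<^sup>2 / K"
          using k [of n m] that by (simp add: dist_real_def cinner_simps)
        then have "K * Re (cinner (T n x - T m x) x) < e\<^sup>2"
          using K by (simp add: field_simps)
        then have "(norm (T n x - T m x))\<^sup>2 < e\<^sup>2" using diff [OF that(2), of x] by linarith
        then show ?thesis using \<open>e > 0\<close> by (simp add: dist_norm power2_less_imp_less)
      qed
      have "dist (T m x) (T n x) < e" if "m \<ge> k" "n \<ge> k" for m n
        using * [of m n] * [of n m] that by (cases "m \<le> n") (auto simp: dist_commute)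
      then show "\<exists>k. \<forall>m\<ge>k. \<forall>n\<ge>k. dist (T m x) (T n x) < e" by blast
    qed
  qed
  then have "\<exists>l. (\<lambda>n. T n x) \<longlonglongrightarrow> l" for x
    using Cauchy_convergent convergentD by blast
  then obtain L where L: "\<And>x. (\<lambda>n. T n x) \<longlonglongrightarrow> L x" by metis
  \<comment> \<open>The uniform bound \<open>K\<close> concerns differences from \<open>T 0\<close>,
    so boundedness is shown for the difference and \<open>T 0\<close> is added back
    afterwards.\<close>
  have "(\<lambda>x. L x - T 0 x) \<in> bounded_ops"
  proof (rule bounded_opsI [where K = K])
    fix x y c
    note [tendsto_intros] = L
    have "(\<lambda>n. T n (x + y)) \<longlonglongrightarrow> L x + L y"
      by (simp add: bounded_opsD [OF T] L tendsto_add)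
    then show "L (x + y) - T 0 (x + y) = L x - T 0 x + (L y - T 0 y)"
      using LIMSEQ_unique [OF L] by (simp add: bounded_opsD [OF T])
    have "(\<lambda>n. T n (c *\<^sub>C x)) \<longlonglongrightarrow> c *\<^sub>C L x"
      using bounded_ops_tendsto [OF bounded_ops_scaleC [OF bounded_ops_ident] L]
      by (simp add: bounded_opsD [OF T])
    then show "L (c *\<^sub>C x) - T 0 (c *\<^sub>C x) = c *\<^sub>C (L x - T 0 x)"
      using LIMSEQ_unique [OF L] by (simp add: bounded_opsD [OF T] scaleC_diff_right)
    have "norm (T n x - T 0 x) \<le> norm x * K" for n
    proof -
      have "(norm (T n x - T 0 x))\<^sup>2 \<le> K * Re (cinner (T n x - T 0 x) x)"
        by (rule diff) simp
      also have "\<dots> \<le> K * (K * (norm x)\<^sup>2)"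
        using bnd [of x] leRe [OF le [of n], of x] K
        by (intro mult_left_mono) (auto simp: cinner_simps)
      also have "\<dots> = (norm x * K)\<^sup>2" by (simp add: power2_eq_square)
      finally show ?thesis by (rule power2_le_imp_le) (use K in simp)
    qed
    moreover have "(\<lambda>n. norm (T n x - T 0 x)) \<longlonglongrightarrow> norm (L x - T 0 x)"
      by (intro tendsto_intros)
    ultimately show "norm (L x - T 0 x) \<le> norm x * K"
      by (intro LIMSEQ_le_const2) auto
  qed
  from bounded_ops_add [OF this T [of 0]] have "L \<in> bounded_ops" by simp
  then show ?thesis using L by (rule that)
qed

lemma op_le_strong_limit:
  assumes "\<And>x. (\<lambda>n. T n x) \<longlonglongrightarrow> L x" and "\<And>n. op_le (T n) U"
  shows "op_le L U"
  unfolding op_le_def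
proof
  fix x
  have "(\<lambda>n. cinner (U x - T n x) x) \<longlonglongrightarrow> cinner (U x - L x) x"
    by (intro tendsto_cinner tendsto_intros assms)
  then show "cinner (U x - L x) x \<in> \<real>\<^sub>\<ge>\<^sub>0"
    by (rule closed_sequentially [OF closed_nonneg_Reals_complex, rotated])
      (use assms(2) in \<open>auto simp: op_le_def\<close>)
qed

lemma strong_limit_op_le:
  fixes T :: "nat \<Rightarrow> 'h::complex_hilbert \<Rightarrow> 'h"
  assumes lim: "\<And>x. (\<lambda>n. T n x) \<longlonglongrightarrow> L x" and inc: "\<And>n. op_le (T n) (T (Suc n))"
  shows "op_le (T m) L"
  unfolding op_le_def
proof
  fix x
  have "(\<lambda>n. cinner (T (n + m) x - T m x) x) \<longlonglongrightarrow> cinner (L x - T m x) x"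
    by (intro tendsto_cinner tendsto_intros LIMSEQ_ignore_initial_segment lim)
  moreover have "cinner (T (n + m) x - T m x) x \<in> \<real>\<^sub>\<ge>\<^sub>0" for n
    using op_le_mono_seq [of T m "n + m"] inc by (simp add: op_le_def)
  ultimately show "cinner (L x - T m x) x \<in> \<real>\<^sub>\<ge>\<^sub>0"
    by (rule closed_sequentially [OF closed_nonneg_Reals_complex, rotated])
qed

section \<open>Powers of a positive contraction\<close>

definition pos_contraction :: "('h::complex_hilbert \<Rightarrow> 'h) \<Rightarrow> bool"
  where "pos_contraction E \<longleftrightarrow> psd_op E \<and> op_le E (\<lambda>x. x)"

lemma pos_contraction_norm_le:
  assumes "pos_contraction E"
  shows "(norm (E x))\<^sup>2 \<le> Re (cinner (E x) x)"
proof -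
  have "Re (cinner (E x) x) \<le> 1 * (norm x)\<^sup>2" for x
    using assms by (simp add: pos_contraction_def op_le_def complex_nonneg_Reals_iff cinner_simps Re_cinner_self)
  then show ?thesis using psd_op_norm_le [of E 1 x] assms by (simp add: pos_contraction_def)
qed

lemma pos_contraction_symmetric:
  "pos_contraction E \<Longrightarrow> cinner (E x) y = cinner x (E y)"
  by (simp add: pos_contraction_def psd_op_symmetric)

lemma funpow_symmetric:
  assumes "\<And>x y. cinner (E x) y = cinner x (E y)"
  shows "cinner ((E ^^ n) x) y = cinner x ((E ^^ n) y)"
  by (induction n arbitrary: x y) (auto simp: assms funpow_swap1)

text \<open>Writing \<open>n\<close> as \<open>2 j\<close> or \<open>2 j + 1\<close> and moving
  \<open>E ^^ j\<close> to the other side of the inner product leaves the form of \<open>D\<close>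
  or of \<open>D E\<close>, evaluated at \<open>(E ^^ j) x\<close>.\<close>

lemma psd_op_funpow_sandwich:
  assumes D: "psd_op D" and E: "pos_contraction E" and comm: "\<And>x. D (E x) = E (D x)"
    and DE: "psd_op (\<lambda>x. D (E x))"
  shows "psd_op (\<lambda>x. D ((E ^^ n) x))"
proof -
  have comm': "D ((E ^^ j) x) = (E ^^ j) (D x)" for j x
    by (induction j) (auto simp: comm)
  have "cinner (D ((E ^^ n) x)) x \<in> \<real>\<^sub>\<ge>\<^sub>0" for x
  proof (cases "even n")
    case True
    then obtain j where "n = j + j" by (metis evenE mult_2)
    then have "cinner (D ((E ^^ n) x)) x = cinner (D ((E ^^ j) x)) ((E ^^ j) x)"
      by (simp add: funpow_add comm' funpow_symmetric [of E, OF pos_contraction_symmetric [OF E]])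
    then show ?thesis using D by (simp add: psd_op_def)
  next
    case False
    then obtain j where "n = Suc (j + j)" by (metis oddE mult_2 Suc_eq_plus1)
    then have "cinner (D ((E ^^ n) x)) x = cinner (D (E ((E ^^ j) x))) ((E ^^ j) x)"
      by (simp add: funpow_add comm comm' funpow_swap1 funpow_symmetric [of E, OF pos_contraction_symmetric [OF E]])
    then show ?thesis using DE by (simp add: psd_op_def)
  qed
  then show ?thesis
    using D E by (auto simp: psd_op_def pos_contraction_def intro: bounded_ops_comp bounded_ops_funpow)
qed

lemma psd_op_funpow:
  assumes "pos_contraction E" shows "psd_op (E ^^ n)"
  using psd_op_funpow_sandwich [of "\<lambda>x. x" E n] assms psd_op_id
  by (simp add: pos_contraction_def id_def)

text \<open>The difference is \<open>D (E ^^ n)\<close> with \<open>D = I - E\<close>. The odd case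
  of the sandwich argument needs \<open>E - E E\<close> to be positive, which is
  \<open>pos_contraction_norm_le\<close>.\<close>

lemma funpow_decreasing:
  assumes E: "pos_contraction E" shows "op_le (E ^^ Suc n) (E ^^ n)"
proof -
  have E': "E \<in> bounded_ops" using E by (simp add: pos_contraction_def psd_op_def)
  have "psd_op (\<lambda>x. (E ^^ n) x - E ((E ^^ n) x))"
  proof (rule psd_op_funpow_sandwich [of "\<lambda>x. x - E x", OF _ E])
    show "psd_op (\<lambda>x. x - E x)"
      using E by (simp add: pos_contraction_def psd_op_def op_le_def bounded_ops_intros)
    show "E x - E (E x) = E (x - E x)" for x by (simp add: bounded_opsD [OF E'])
    show "psd_op (\<lambda>x. E x - E (E x))"
      unfolding psd_op_def
    proof (intro conjI allI)
      show "(\<lambda>x. E x - E (E x)) \<in> bounded_ops" by (intro bounded_ops_diff bounded_ops_comp [of E E] E')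
      fix x
      have "cinner (E x) x \<in> \<real>\<^sub>\<ge>\<^sub>0" using E by (simp add: pos_contraction_def psd_op_def)
      moreover have "cinner (E x - E (E x)) x = cinner (E x) x - complex_of_real ((norm (E x))\<^sup>2)"
        by (simp add: cinner_simps pos_contraction_symmetric [OF E, of "E x"] cinner_self del: of_real_power)
      ultimately show "cinner (E x - E (E x)) x \<in> \<real>\<^sub>\<ge>\<^sub>0"
        using pos_contraction_norm_le [OF E, of x]
        by (simp add: complex_nonneg_Reals_iff del: of_real_power)
    qed
  qed
  then show ?thesis by (simp add: psd_op_def op_le_def)
qed

section \<open>Von Neumann algebras\<close>

locale vn_algebra =
  fixes M :: "('h::complex_hilbert \<Rightarrow> 'h) set"
  assumes vn: "von_neumann_algebra M"
begin

lemma bounded: "A \<in> M \<Longrightarrow> A \<in> bounded_ops"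
  using vn by (auto simp: von_neumann_algebra_def)

lemma adj_closed: "A \<in> M \<Longrightarrow> adj A \<in> M"
  using vn by (auto simp: von_neumann_algebra_def)

lemma commute: "A \<in> M \<Longrightarrow> U \<in> commutant M \<Longrightarrow> A (U x) = U (A x)"
  by (auto simp: commutant_def fun_eq_iff)

text \<open>The bicommutant identity as a membership test. All closure properties of
  \<open>M\<close>, including those for strong limits, range projections and Douglas factors, reduce
  through it to commutation with the commutant.\<close>

lemma memI:
  assumes "A \<in> bounded_ops" "\<And>U x. U \<in> commutant M \<Longrightarrow> A (U x) = U (A x)"
  shows "A \<in> M"
proof -
  have "A \<in> commutant (commutant M)"
    using assms by (auto simp: commutant_def [of "commutant M"])
  then show ?thesis using vn by (simp add: von_neumann_algebra_def)
qed

lemma commutant_bounded: "U \<in> commutant M \<Longrightarrow> U \<in> bounded_ops"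
  by (simp add: commutant_def)

lemma commutant_adj:
  assumes "U \<in> commutant M" shows "adj U \<in> commutant M"
proof -
  note U = commutant_bounded [OF assms]
  have "A (adj U x) = adj U (A x)" if "A \<in> M" for A x
  proof (rule cinner_ext)
    fix z
    note A = bounded [OF that]
    have "adj A (U z) = U (adj A z)" using commute [OF adj_closed [OF that] assms] .
    then show "cinner (A (adj U x)) z = cinner (adj U (A x)) z"
      by (simp add: cinner_adj [OF A] cinner_adj' [OF U])
  qed
  then show ?thesis by (auto simp: commutant_def bounded_ops_adj [OF U])
qed

lemma ident_closed: "(\<lambda>x. x) \<in> M" and id_closed: "id \<in> M"
  by (auto intro!: memI bounded_ops_intros)

lemma zero_closed: "(\<lambda>x. 0) \<in> M"
  by (auto intro!: memI bounded_ops_intros simp: bounded_opsD(5) commutant_bounded)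

lemma add_closed: "A \<in> M \<Longrightarrow> B \<in> M \<Longrightarrow> (\<lambda>x. A x + B x) \<in> M"
  by (auto intro!: memI bounded_ops_intros simp: bounded commute bounded_opsD(1) [OF commutant_bounded])

lemma diff_closed: "A \<in> M \<Longrightarrow> B \<in> M \<Longrightarrow> (\<lambda>x. A x - B x) \<in> M"
  by (auto intro!: memI bounded_ops_intros simp: bounded commute bounded_opsD(3) [OF commutant_bounded])

lemma scaleC_closed: "A \<in> M \<Longrightarrow> (\<lambda>x. c *\<^sub>C A x) \<in> M"
  by (auto intro!: memI bounded_ops_intros simp: bounded commute bounded_opsD(2) [OF commutant_bounded])

lemma comp_closed: "A \<in> M \<Longrightarrow> B \<in> M \<Longrightarrow> (\<lambda>x. A (B x)) \<in> M"
  by (rule memI) (auto intro: bounded_ops_comp bounded simp: commute)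

lemma funpow_closed: "A \<in> M \<Longrightarrow> A ^^ n \<in> M"
  by (induction n) (auto simp: id_closed comp_closed o_def)

lemma sum_closed:
  fixes A :: "nat \<Rightarrow> 'h \<Rightarrow> 'h"
  shows "(\<And>i. A i \<in> M) \<Longrightarrow> (\<lambda>x. \<Sum>i<n. A i x) \<in> M"
  by (induction n) (auto simp: zero_closed add_closed)

lemma strong_limit_closed:
  assumes "\<And>n. T n \<in> M" "L \<in> bounded_ops" "\<And>x. (\<lambda>n. T n x) \<longlonglongrightarrow> L x"
  shows "L \<in> M"
proof (rule memI)
  fix U x assume U: "U \<in> commutant M"
  have "(\<lambda>n. T n (U x)) \<longlonglongrightarrow> U (L x)"
    using bounded_ops_tendsto [OF commutant_bounded [OF U] assms(3)] assms(1)
    by (simp add: commute [OF _ U])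
  then show "L (U x) = U (L x)" using assms(3) LIMSEQ_unique by blast
qed (rule assms)

lemma self_adjoint_part_iff:
  "A \<in> self_adjoint_part M \<longleftrightarrow> A \<in> M \<and> (\<forall>x y. cinner (A x) y = cinner x (A y))"
  by (auto simp: self_adjoint_part_def adj_self_iff bounded)

lemma self_adjoint_strong_limit:
  assumes "\<And>n. T n \<in> self_adjoint_part M" "L \<in> bounded_ops" "\<And>x. (\<lambda>n. T n x) \<longlonglongrightarrow> L x"
  shows "L \<in> self_adjoint_part M"
  unfolding self_adjoint_part_iff
proof (intro conjI allI)
  show "L \<in> M" using assms strong_limit_closed [of T L] by (simp add: self_adjoint_part_iff)
  fix x y
  have "(\<lambda>n. cinner (T n x) y) \<longlonglongrightarrow> cinner (L x) y" by (intro tendsto_cinner assms tendsto_const)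
  moreover have "(\<lambda>n. cinner (T n x) y) \<longlonglongrightarrow> cinner x (L y)"
    using assms(1) tendsto_cinner [OF tendsto_const assms(3), of x y] by (simp add: self_adjoint_part_iff)
  ultimately show "cinner (L x) y = cinner x (L y)" by (rule LIMSEQ_unique)
qed

text \<open>Normality speaks of suprema within the self-adjoint part, whereas the constructions
  produce strong limits of sequences; this translates the second into the first.\<close>

lemma is_lub_strong_limit:
  assumes "\<And>n. T n \<in> self_adjoint_part M" "L \<in> bounded_ops" "\<And>x. (\<lambda>n. T n x) \<longlonglongrightarrow> L x"
    and "\<And>n. op_le (T n) (T (Suc n))"
  shows "is_lub_in (self_adjoint_part M) (range T) L"
  unfolding is_lub_in_def
  using self_adjoint_strong_limit [of T L] assms strong_limit_op_le [of T L] op_le_strong_limit [of T L]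
  by auto

end

lemma is_lub_in_unique:
  assumes "is_lub_in X D T" "is_lub_in X D T'" "X \<subseteq> bounded_ops"
  shows "T = T'"
  using assms by (auto simp: is_lub_in_def intro!: op_le_antisym)

section \<open>Douglas factorization\<close>

lemma Baire_union_interior:
  fixes F :: "nat \<Rightarrow> 'a::banach set"
  assumes "\<And>n. closed (F n)" "(\<Union>n. F n) = UNIV"
  obtains n z r where "r > 0" "cball z r \<subseteq> F n"
proof -
  have "\<exists>n. interior (F n) \<noteq> {}"
  proof (rule ccontr)
    assume "\<nexists>n. interior (F n) \<noteq> {}"
    then have "euclidean interior_of \<Union>(range F) = {}"
      using assms completely_metrizable_space_euclidean
      by (intro Baire_category_alt) auto
    then show False using assms(2) by simp
  qed
  then obtain n z where "z \<in> interior (F n)" by blast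
  then show ?thesis using that by (auto simp: mem_interior_cball)
qed

text \<open>A Baire argument. Each \<open>F n\<close> is closed, and if \<open>B x = C y\<close>
  then \<open>x\<close> lies in \<open>F n\<close> as soon as \<open>norm y \<le> n\<close>, so the
  sets cover the space and one of them contains a ball.\<close>

lemma Douglas_bound:
  fixes B C :: "'h::complex_hilbert \<Rightarrow> 'h"
  assumes B: "B \<in> bounded_ops" and C: "C \<in> bounded_ops" and sub: "range B \<subseteq> range C"
  obtains K where "K \<ge> 0" "\<And>x z. cmod (cinner (B x) z) \<le> K * norm x * norm (adj C z)"
proof -
  define F where "F n = {x. \<forall>z. cmod (cinner (B x) z) \<le> real n * norm (adj C z)}" for n :: nat
  have "closed (F n)" for n
  proof -
    have "F n = (\<Inter>z. {x. cmod (cinner (B x) z) \<le> real n * norm (adj C z)})"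
      by (auto simp: F_def)
    moreover have "continuous_on UNIV (\<lambda>x. cmod (cinner (B x) z))" for z
      by (intro continuous_on_norm continuous_on_cinner continuous_on_const
          linear_continuous_on bounded_opsD(6) [OF B])
    ultimately show ?thesis
      by (auto intro!: closed_INT closed_Collect_le continuous_on_const)
  qed
  moreover have "(\<Union>n. F n) = UNIV"
  proof -
    have "x \<in> (\<Union>n. F n)" for x
    proof -
      obtain y where y: "B x = C y" using sub by blast
      obtain n where n: "norm y \<le> real n" using real_arch_simple by blast
      have "cmod (cinner (B x) z) \<le> real n * norm (adj C z)" for z
      proof -
        have "cmod (cinner (B x) z) \<le> norm y * norm (adj C z)"
          by (metis Cauchy_Schwarz cinner_adj [OF C] y)
        also have "\<dots> \<le> real n * norm (adj C z)" using n by (intro mult_right_mono) auto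
        finally show ?thesis .
      qed
      then show ?thesis by (auto simp: F_def)
    qed
    then show ?thesis by blast
  qed
  ultimately obtain n y r where r: "r > 0" "cball y r \<subseteq> F n"
    by (rule Baire_union_interior)
  \<comment> \<open>\<open>s *\<^sub>R x\<close> with \<open>s * norm x = r\<close> is the
    difference of two points of the ball; each contributes \<open>n\<close>, and rescaling by
    \<open>s\<close> divides by \<open>r\<close>.\<close>
  define K where "K = 2 * real n / r"
  have "cmod (cinner (B x) z) \<le> K * norm x * norm (adj C z)" for x z
  proof (cases "x = 0")
    case False
    define s where "s = r / norm x"
    have s: "s > 0" "s * norm x = r" using r False by (auto simp: s_def)
    have "y + s *\<^sub>R x \<in> F n" "y \<in> F n" using r s by (auto simp: dist_norm subset_eq)
    then have "cmod (cinner (B (y + s *\<^sub>R x)) z) \<le> real n * norm (adj C z)"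
      "cmod (cinner (B y) z) \<le> real n * norm (adj C z)" by (auto simp: F_def)
    moreover have "complex_of_real s * cinner (B x) z = cinner (B (y + s *\<^sub>R x)) z - cinner (B y) z"
      by (simp add: bounded_opsD [OF B] scaleR_scaleC cinner_simps)
    ultimately have "cmod (complex_of_real s * cinner (B x) z) \<le> 2 * real n * norm (adj C z)"
      using norm_triangle_ineq4 [of "cinner (B (y + s *\<^sub>R x)) z" "cinner (B y) z"] by simp
    then have "s * cmod (cinner (B x) z) \<le> 2 * real n * norm (adj C z)"
      using s by (simp add: norm_mult)
    then have "cmod (cinner (B x) z) \<le> 2 * real n * norm (adj C z) / s"
      using s by (simp add: field_simps)
    also have "\<dots> = K * norm x * norm (adj C z)"
      using r False by (simp add: K_def s_def)
    finally show ?thesis .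
  qed (simp add: bounded_opsD [OF B])
  moreover have "K \<ge> 0" using r by (simp add: K_def)
  ultimately show ?thesis using that by blast
qed

context vn_algebra
begin

text \<open>\<open>X x\<close> is the solution of \<open>C y = B x\<close> in the closed range of
  \<open>adj C\<close>, which is the orthogonal complement of the null space of \<open>C\<close>.
  Uniqueness there makes \<open>X\<close> linear. It also makes \<open>X\<close> commute with every
  \<open>U\<close> in the commutant, because such a \<open>U\<close> commutes with
  \<open>adj C\<close> and hence preserves that closed range.\<close>

theorem Douglas_factorization:
  assumes B: "B \<in> M" and C: "C \<in> M" and sub: "range B \<subseteq> range C"
  obtains X where "X \<in> M" "\<And>x. B x = C (X x)"
proof -
  note bB = bounded [OF B] and bC = bounded [OF C]
  define R where "R = closure (range (adj C))"
  have cR: "csubspace R"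
    unfolding R_def by (intro csubspace_closure csubspace_range bounded_ops_adj bC)
  have Cuniq: "y = y'" if "y \<in> R" "y' \<in> R" "C y = C y'" for y y'
  proof -
    define d where "d = y - y'"
    have d: "d \<in> R" "C d = 0"
      using csubspace_diff [OF cR that(1,2)] that(3) by (auto simp: d_def bounded_opsD [OF bC])
    then obtain f where f: "\<And>n. f n \<in> range (adj C)" "f \<longlonglongrightarrow> d"
      by (auto simp: R_def closure_sequential)
    have "cinner d (f n) = 0" for n
      using f(1) [of n] d(2) by (auto simp: cinner_adj [OF bC, symmetric])
    moreover have "(\<lambda>n. cinner d (f n)) \<longlonglongrightarrow> cinner d d" by (intro tendsto_cinner tendsto_const f)
    ultimately have "d = 0" by (simp add: LIMSEQ_const_iff)
    then show ?thesis by (simp add: d_def)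
  qed
  have "\<exists>y. y \<in> R \<and> C y = B x" for x
  proof -
    obtain w where w: "B x = C w" using sub by blast
    have "closed R" by (simp add: R_def)
    then obtain p where p: "p \<in> R" "\<And>l. l \<in> R \<Longrightarrow> cinner (w - p) l = 0"
      using projection_theorem [OF cR, of w] by metis
    have "C (w - p) = 0"
    proof (rule cinner_ext)
      fix z
      have "adj C z \<in> R" using closure_subset [of "range (adj C)"] by (auto simp: R_def)
      then show "cinner (C (w - p)) z = cinner 0 z" using p(2) by (simp add: cinner_adj [OF bC])
    qed
    then show ?thesis using p(1) w by (auto simp: bounded_opsD [OF bC])
  qed
  then obtain X where X: "\<And>x. X x \<in> R" "\<And>x. C (X x) = B x" by metis
  obtain K where K: "K \<ge> 0" "\<And>x z. cmod (cinner (B x) z) \<le> K * norm x * norm (adj C z)"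
    using Douglas_bound [OF bB bC sub] by metis
  have bX: "X \<in> bounded_ops"
  proof (rule bounded_opsI [where K = K])
    fix x y c
    show "X (x + y) = X x + X y"
      by (rule Cuniq) (use cR X in \<open>auto simp: csubspace_def bounded_opsD [OF bB] bounded_opsD [OF bC]\<close>)
    show "X (c *\<^sub>C x) = c *\<^sub>C X x"
      by (rule Cuniq) (use cR X in \<open>auto simp: csubspace_def bounded_opsD [OF bB] bounded_opsD [OF bC]\<close>)
    \<comment> \<open>The bound \<open>K\<close> is stated for vectors \<open>adj C z\<close>. These
      only approximate \<open>X x\<close>, so the estimate of \<open>cinner (X x) (X x)\<close> is a
      limit.\<close>
    obtain f where f: "\<And>n. f n \<in> range (adj C)" "f \<longlonglongrightarrow> X x"
      using X(1) [of x] by (auto simp: R_def closure_sequential)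
    have "cmod (cinner (X x) (f n)) \<le> K * norm x * norm (f n)" for n
    proof -
      obtain z where "f n = adj C z" using f(1) [of n] by blast
      then show ?thesis using K(2) [of x z] by (simp add: cinner_adj [OF bC, symmetric] X)
    qed
    moreover have "(\<lambda>n. cmod (cinner (X x) (f n))) \<longlonglongrightarrow> cmod (cinner (X x) (X x))"
      by (intro tendsto_norm tendsto_cinner tendsto_const f)
    moreover have "(\<lambda>n. K * norm x * norm (f n)) \<longlonglongrightarrow> K * norm x * norm (X x)"
      by (intro tendsto_mult tendsto_const tendsto_norm f)
    ultimately have "cmod (cinner (X x) (X x)) \<le> K * norm x * norm (X x)"
      by (intro LIMSEQ_le) auto
    then have "norm (X x) * norm (X x) \<le> (norm x * K) * norm (X x)"
      by (simp add: cinner_self norm_mult power2_eq_square mult_ac)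
    then show "norm (X x) \<le> norm x * K"
      using K(1) by (cases "X x = 0") (simp, metis mult_right_le_imp_le zero_less_norm_iff)
  qed
  have "X \<in> M"
  proof (rule memI [OF bX])
    fix U x assume U: "U \<in> commutant M"
    note bU = commutant_bounded [OF U]
    have "U (X x) \<in> R"
    proof -
      obtain f where f: "\<And>n. f n \<in> range (adj C)" "f \<longlonglongrightarrow> X x"
        using X(1) [of x] by (auto simp: R_def closure_sequential)
      have "U (f n) \<in> range (adj C)" for n
      proof -
        obtain z where "f n = adj C z" using f(1) [of n] by blast
        then have "U (f n) = adj C (U z)" using commute [OF adj_closed [OF C] U] by simp
        then show ?thesis by blast
      qed
      moreover have "(\<lambda>n. U (f n)) \<longlonglongrightarrow> U (X x)" by (rule bounded_ops_tendsto [OF bU f(2)])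
      ultimately show ?thesis
        unfolding R_def closure_sequential by (intro exI [of _ "\<lambda>n. U (f n)"]) simp
    qed
    moreover have "C (X (U x)) = C (U (X x))"
      by (simp add: X commute [OF C U] commute [OF B U])
    ultimately show "X (U x) = U (X x)" by (intro Cuniq [of "X (U x)" "U (X x)"] X(1))
  qed
  then show ?thesis using X by (intro that [of X]) auto
qed

end

section \<open>Normal homomorphisms and quotients\<close>

locale normal_hom = M: vn_algebra M + N: vn_algebra N
  for M :: "('h::complex_hilbert \<Rightarrow> 'h) set" and N :: "('k::complex_hilbert \<Rightarrow> 'k) set" +
  fixes \<Phi> :: "('h \<Rightarrow> 'h) \<Rightarrow> ('k \<Rightarrow> 'k)"
  assumes hom: "unital_star_hom M N \<Phi>" and normal: "normal_map M N \<Phi>"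
begin

lemma hom_closed: "A \<in> M \<Longrightarrow> \<Phi> A \<in> N"
  and hom_add: "A \<in> M \<Longrightarrow> B \<in> M \<Longrightarrow> \<Phi> (\<lambda>x. A x + B x) = (\<lambda>x. \<Phi> A x + \<Phi> B x)"
  and hom_scaleC: "A \<in> M \<Longrightarrow> \<Phi> (\<lambda>x. c *\<^sub>C A x) = (\<lambda>x. c *\<^sub>C \<Phi> A x)"
  and hom_comp: "A \<in> M \<Longrightarrow> B \<in> M \<Longrightarrow> \<Phi> (A \<circ> B) = \<Phi> A \<circ> \<Phi> B"
  and hom_adj: "A \<in> M \<Longrightarrow> \<Phi> (adj A) = adj (\<Phi> A)"
  and hom_id: "\<Phi> id = id"
  using hom by (auto simp: unital_star_hom_def)

lemma hom_comp': "A \<in> M \<Longrightarrow> B \<in> M \<Longrightarrow> \<Phi> (\<lambda>x. A (B x)) = (\<lambda>x. \<Phi> A (\<Phi> B x))"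
  using hom_comp by (simp add: o_def)

lemma hom_ident: "\<Phi> (\<lambda>x. x) = (\<lambda>x. x)"
  using hom_id by (simp add: id_def)

lemma hom_zero: "\<Phi> (\<lambda>x. 0) = (\<lambda>x. 0)"
  using hom_scaleC [OF M.zero_closed, of 0] by simp

lemma hom_diff: "A \<in> M \<Longrightarrow> B \<in> M \<Longrightarrow> \<Phi> (\<lambda>x. A x - B x) = (\<lambda>x. \<Phi> A x - \<Phi> B x)"
  using hom_add [OF _ M.scaleC_closed, of A B "-1"] hom_scaleC [of B "-1"] by simp

lemma hom_funpow: "A \<in> M \<Longrightarrow> \<Phi> (A ^^ n) = \<Phi> A ^^ n"
  by (induction n) (simp_all add: hom_id hom_comp M.funpow_closed)

lemma hom_sum:
  fixes A :: "nat \<Rightarrow> 'h \<Rightarrow> 'h"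
  shows "(\<And>i. A i \<in> M) \<Longrightarrow> \<Phi> (\<lambda>x. \<Sum>i<n. A i x) = (\<lambda>x. \<Sum>i<n. \<Phi> (A i) x)"
  by (induction n) (simp_all add: hom_zero hom_add M.sum_closed)

lemma hom_self_adjoint: "A \<in> self_adjoint_part M \<Longrightarrow> \<Phi> A \<in> self_adjoint_part N"
  by (auto simp: self_adjoint_part_def hom_closed hom_adj [symmetric])

lemma hom_is_lub:
  assumes "D \<subseteq> self_adjoint_part M" "D \<noteq> {}" "\<And>A B. A \<in> D \<Longrightarrow> B \<in> D \<Longrightarrow> \<exists>C\<in>D. op_le A C \<and> op_le B C"
    "is_lub_in (self_adjoint_part M) D T"
  shows "is_lub_in (self_adjoint_part N) (\<Phi> ` D) (\<Phi> T)"
  using normal assms unfolding normal_map_def by blast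

text \<open>Monotonicity is normality applied to the directed set \<open>{A, B}\<close>, so that no square roots
  in \<open>M\<close> are needed.\<close>

lemma hom_op_le:
  assumes "A \<in> self_adjoint_part M" "B \<in> self_adjoint_part M" "op_le A B"
  shows "op_le (\<Phi> A) (\<Phi> B)"
proof -
  have "is_lub_in (self_adjoint_part N) (\<Phi> ` {A, B}) (\<Phi> B)"
    using assms by (intro hom_is_lub) (auto simp: is_lub_in_def op_le_refl)
  then show ?thesis by (auto simp: is_lub_in_def)
qed

text \<open>Normality makes \<open>\<Phi> L\<close> the supremum of the images. The images increase,
  so they converge strongly in \<open>N\<close>, and their limit is a supremum as well; uniqueness
  of suprema identifies the two.\<close>

lemma hom_strong_limit:
  assumes T: "\<And>n. T n \<in> self_adjoint_part M" and L: "L \<in> bounded_ops"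
    and lim: "\<And>x. (\<lambda>n. T n x) \<longlonglongrightarrow> L x" and inc: "\<And>n. op_le (T n) (T (Suc n))"
  shows "(\<lambda>n. \<Phi> (T n) y) \<longlonglongrightarrow> \<Phi> L y"
proof -
  have "is_lub_in (self_adjoint_part N) (\<Phi> ` range T) (\<Phi> L)"
  proof (rule hom_is_lub)
    show "is_lub_in (self_adjoint_part M) (range T) L"
      by (rule M.is_lub_strong_limit [OF assms])
    fix A B assume "A \<in> range T" "B \<in> range T"
    then obtain m n where "A = T m" "B = T n" by blast
    moreover have "op_le (T m) (T (max m n))" "op_le (T n) (T (max m n))"
      by (rule op_le_mono_seq [of T, OF inc]; simp)+
    ultimately show "\<exists>C\<in>range T. op_le A C \<and> op_le B C" by blast
  qed (use T in auto)
  then have lub: "is_lub_in (self_adjoint_part N) (range (\<lambda>n. \<Phi> (T n))) (\<Phi> L)"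
    by (simp add: image_image)
  have T': "\<Phi> (T n) \<in> self_adjoint_part N" for n by (rule hom_self_adjoint [OF T])
  have inc': "op_le (\<Phi> (T n)) (\<Phi> (T (Suc n)))" for n by (rule hom_op_le [OF T T inc])
  have sub: "self_adjoint_part N \<subseteq> bounded_ops" by (auto simp: self_adjoint_part_def N.bounded)
  have "\<Phi> L \<in> bounded_ops" "\<And>n. op_le (\<Phi> (T n)) (\<Phi> L)" "\<And>n. \<Phi> (T n) \<in> bounded_ops"
    using lub T' sub by (auto simp: is_lub_in_def)
  then obtain L' where L': "L' \<in> bounded_ops" "\<And>y. (\<lambda>n. \<Phi> (T n) y) \<longlonglongrightarrow> L' y"
    using monotone_strong_limit [of "\<lambda>n. \<Phi> (T n)" "\<Phi> L"] inc' by metis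
  have "L' = \<Phi> L"
    by (rule is_lub_in_unique [OF N.is_lub_strong_limit [of "\<lambda>n. \<Phi> (T n)", OF T' L' inc'] lub sub])
  then show ?thesis using L'(2) by simp
qed

text \<open>The kernel projection of \<open>B\<close> is the limit of the decreasing sequence \<open>(1 - c B* B)\<^sup>n\<close>
  for small \<open>c\<close>.\<close>

lemma hom_null_space:
  assumes A: "A \<in> M" and B: "B \<in> M" and null: "null_space B \<subseteq> null_space A"
  shows "null_space (\<Phi> B) \<subseteq> null_space (\<Phi> A)"
proof -
  note bB = M.bounded [OF B]
  obtain K where K: "K > 0" "\<And>x. norm (B x) \<le> K * norm x" using bounded_ops_bound [OF bB] by metis
  \<comment> \<open>With this \<open>c\<close> the operator \<open>c adj B B\<close> lies between 0
    and I, so that \<open>E\<close> does too.\<close>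
  define c where "c = 1 / K\<^sup>2"
  define E where "E = (\<lambda>x. x - complex_of_real c *\<^sub>C adj B (B x))"
  have BB: "(\<lambda>x. adj B (B x)) \<in> M" by (rule M.comp_closed [OF M.adj_closed [OF B] B])
  have EM: "E \<in> M" unfolding E_def by (intro M.diff_closed M.ident_closed M.scaleC_closed BB)
  note bE = M.bounded [OF EM]
  have c: "c > 0" using K by (simp add: c_def)
  have cB: "c * (norm (B x))\<^sup>2 \<le> (norm x)\<^sup>2" for x
  proof -
    have "(norm (B x))\<^sup>2 \<le> (K * norm x)\<^sup>2" by (intro power_mono K) auto
    then show ?thesis using K by (simp add: c_def field_simps)
  qed
  have form: "cinner (E x) x = complex_of_real ((norm x)\<^sup>2 - c * (norm (B x))\<^sup>2)" for x
    by (simp add: E_def cinner_simps cinner_adj' [OF bB] cinner_self)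
  have pE: "pos_contraction E"
    unfolding pos_contraction_def psd_op_def op_le_def
  proof (intro conjI allI bE)
    fix x
    show "cinner (E x) x \<in> \<real>\<^sub>\<ge>\<^sub>0" unfolding form using cB [of x] by (simp del: of_real_diff)
    have "cinner (x - E x) x = complex_of_real (c * (norm (B x))\<^sup>2)"
      by (simp add: E_def cinner_simps cinner_adj' [OF bB] cinner_self)
    then show "cinner (x - E x) x \<in> \<real>\<^sub>\<ge>\<^sub>0" using c by (simp del: of_real_mult of_real_power)
  qed
  define T where "T n = (\<lambda>x. x - (E ^^ n) x)" for n
  have TM: "T n \<in> self_adjoint_part M" for n
    using M.diff_closed [OF M.ident_closed M.funpow_closed [OF EM]]
    by (simp add: M.self_adjoint_part_iff T_def cinner_simps
        funpow_symmetric [of E, OF pos_contraction_symmetric [OF pE]])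
  have inc: "op_le (T n) (T (Suc n))" for n
    using funpow_decreasing [OF pE, of n] by (simp add: op_le_def T_def)
  have "op_le (T n) (\<lambda>x. x)" for n
    using psd_op_funpow [OF pE, of n] by (simp add: op_le_def T_def psd_op_def)
  then obtain L where L: "L \<in> bounded_ops" "\<And>x. (\<lambda>n. T n x) \<longlonglongrightarrow> L x"
    using monotone_strong_limit [of T "\<lambda>x. x"] TM inc M.bounded bounded_ops_ident
    unfolding M.self_adjoint_part_iff by blast
  have LM: "L \<in> M"
    using M.self_adjoint_strong_limit [OF TM L] by (simp add: M.self_adjoint_part_iff)
  define Q where "Q = (\<lambda>x. x - L x)"
  have QM: "Q \<in> M" unfolding Q_def by (intro M.diff_closed M.ident_closed LM)
  have limQ: "(\<lambda>n. (E ^^ n) x) \<longlonglongrightarrow> Q x" for x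
    using tendsto_diff [OF tendsto_const L(2), of x x] by (simp add: T_def Q_def)
  \<comment> \<open>This replaces the inclusion of null spaces by the identity
    \<open>A Q = 0\<close> between elements of \<open>M\<close>, which \<open>\<Phi>\<close>
    preserves. A vector \<open>Q x\<close> is fixed by \<open>E\<close>, hence killed by
    \<open>adj B B\<close>, hence by \<open>B\<close>, hence by \<open>A\<close>.\<close>
  have AQ: "A (Q x) = 0" for x
  proof -
    have "(\<lambda>n. (E ^^ Suc n) x) \<longlonglongrightarrow> E (Q x)"
      using bounded_ops_tendsto [OF bE limQ] by simp
    then have "E (Q x) = Q x" using LIMSEQ_unique LIMSEQ_Suc [OF limQ] by blast
    then have "complex_of_real c *\<^sub>C adj B (B (Q x)) = 0" by (simp add: E_def)
    then have "cinner (complex_of_real c *\<^sub>C adj B (B (Q x))) (Q x) = 0" by simp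
    then have "B (Q x) = 0" using c by (simp add: cinner_simps cinner_adj' [OF bB])
    then show ?thesis using null by (auto simp: null_space_def)
  qed
  show ?thesis
  proof
    fix y assume "y \<in> null_space (\<Phi> B)"
    then have y: "\<Phi> B y = 0" by (simp add: null_space_def)
    have PhiE: "\<Phi> E = (\<lambda>x. x - complex_of_real c *\<^sub>C adj (\<Phi> B) (\<Phi> B x))"
      unfolding E_def
      by (simp add: hom_diff hom_ident hom_scaleC hom_comp' [of "adj B" B] hom_adj B BB
          M.ident_closed M.scaleC_closed M.adj_closed)
    \<comment> \<open>A null vector of \<open>\<Phi> B\<close> is fixed by \<open>\<Phi> E\<close>
      and by all its powers, hence by their strong limit \<open>\<Phi> Q\<close>.\<close>
    have "\<Phi> E y = y"
      using y bounded_opsD(5) [OF N.bounded [OF N.adj_closed [OF hom_closed [OF B]]]]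
      by (simp add: PhiE)
    then have "(\<Phi> E ^^ n) y = y" for n by (induction n) auto
    then have "\<Phi> (T n) y = 0" for n
      by (simp add: T_def hom_diff hom_ident hom_funpow EM M.ident_closed M.funpow_closed)
    then have "\<Phi> L y = 0"
      using hom_strong_limit [OF TM L inc, of y] by (simp add: LIMSEQ_const_iff)
    then have "\<Phi> Q y = y"
      by (simp add: Q_def hom_diff hom_ident M.ident_closed LM)
    moreover have "\<Phi> A (\<Phi> Q y) = 0"
      using hom_comp' [OF A QM] AQ hom_zero by (simp add: fun_eq_iff)
    ultimately show "y \<in> null_space (\<Phi> A)" by (simp add: null_space_def)
  qed
qed

text \<open>Douglas factorization gives \<open>B = B' X\<close>; the null space condition for
  \<open>A'\<close> and \<open>B'\<close> then forces \<open>A = A' X\<close>. Applying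
  \<open>\<Phi>\<close> to both identities shows the inclusion, with \<open>\<Phi> X\<close>
  providing the witnesses. Used in both directions it makes \<open>aff_map\<close> independent of
  the representation.\<close>

lemma op_quotient_hom_subset:
  assumes A: "A \<in> M" and B: "B \<in> M" and A': "A' \<in> M" and B': "B' \<in> M"
    and null: "null_space B' \<subseteq> null_space A'" and eq: "op_quotient A B = op_quotient A' B'"
  shows "op_quotient (\<Phi> A) (\<Phi> B) \<subseteq> op_quotient (\<Phi> A') (\<Phi> B')"
proof -
  have ex: "\<exists>y. B x = B' y \<and> A x = A' y" for x
    using eq unfolding op_quotient_def by blast
  then have "range B \<subseteq> range B'" by blast
  then obtain X where X: "X \<in> M" "\<And>x. B x = B' (X x)"
    using M.Douglas_factorization [OF B B'] by metis
  have "A x = A' (X x)" for x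
  proof -
    obtain y where y: "B x = B' y" "A x = A' y" using ex by blast
    then have "y - X x \<in> null_space B'"
      using X by (simp add: null_space_def bounded_opsD [OF M.bounded [OF B']])
    then have "A' (y - X x) = 0" using null by (auto simp: null_space_def)
    then show ?thesis using y by (simp add: bounded_opsD [OF M.bounded [OF A']])
  qed
  then have "A = (\<lambda>x. A' (X x))" "B = (\<lambda>x. B' (X x))" using X by auto
  then have "\<Phi> A = (\<lambda>x. \<Phi> A' (\<Phi> X x))" "\<Phi> B = (\<lambda>x. \<Phi> B' (\<Phi> X x))"
    using hom_comp' A' B' X(1) by auto
  then show ?thesis by (auto simp: op_quotient_def)
qed

lemma aff_map_op_quotient:
  assumes A: "A \<in> M" and B: "B \<in> M" and null: "null_space B \<subseteq> null_space A"
  shows "aff_map M \<Phi> (op_quotient A B) = op_quotient (\<Phi> A) (\<Phi> B)"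
  unfolding aff_map_def
proof (rule the_equality)
  fix R
  assume "\<exists>A'\<in>M. \<exists>B'\<in>M. null_space B' \<subseteq> null_space A' \<and> op_quotient A B = op_quotient A' B' \<and>
    R = op_quotient (\<Phi> A') (\<Phi> B')"
  then show "R = op_quotient (\<Phi> A) (\<Phi> B)"
    using op_quotient_hom_subset A B null by (metis subset_antisym)
qed (use assms in blast)

end

section \<open>Extremal extensions of a partial resolvent\<close>

text \<open>\<open>P\<close> is the projection onto the range of \<open>S + I\<close>, and \<open>G\<close> is the inverse of
  \<open>S + I\<close> on that range, extended by zero.\<close>

definition partial_resolvent :: "('h::complex_hilbert \<Rightarrow> 'h) \<Rightarrow> ('h \<Rightarrow> 'h) \<Rightarrow> bool"
  where "partial_resolvent P G \<longleftrightarrow> P \<in> bounded_ops \<and> G \<in> bounded_ops \<and>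
    (\<forall>x y. cinner (P x) y = cinner x (P y)) \<and> (\<forall>x. P (P x) = P x) \<and> (\<forall>x. G (P x) = G x) \<and>
    (\<forall>x y. cinner (P (G x)) y = cinner x (P (G y))) \<and>
    (\<forall>x. (norm (G x))\<^sup>2 \<le> Re (cinner (P (G x)) x))"

text \<open>When \<open>G\<close> has dense range these are exactly the resolvents of the positive
  self-adjoint extensions (\<open>psa_extensions_resolvents\<close>). Density is no part of the
  definition because the class is also used for \<open>P - G\<close>, whose range is that of
  \<open>S\<close> and may fail to be dense.\<close>

definition resolvents :: "('h::complex_hilbert \<Rightarrow> 'h) \<Rightarrow> ('h \<Rightarrow> 'h) \<Rightarrow> ('h \<Rightarrow> 'h) set"
  where "resolvents P G = {R. pos_contraction R \<and> (\<forall>x. R (P x) = G x)}"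

text \<open>Formally the least positive \<open>R\<close> with \<open>R P = G\<close> is \<open>G a\<inverse> G*\<close> with \<open>a = P G\<close>;
  here \<open>a\<inverse>\<close> is replaced by the partial sums of its Neumann series.\<close>

definition resolvent_approx ::
    "('h::complex_hilbert \<Rightarrow> 'h) \<Rightarrow> ('h \<Rightarrow> 'h) \<Rightarrow> nat \<Rightarrow> 'h \<Rightarrow> 'h"
  where "resolvent_approx P G n x = (\<Sum>k<n. G (((\<lambda>x. x - P (G x)) ^^ k) (adj G x)))"

lemma sq_le_mult_imp_le:
  fixes q :: real
  assumes "q\<^sup>2 \<le> q * b" "q \<ge> 0" "b \<ge> 0" shows "q \<le> b"
  using assms by (cases "q = 0") (auto simp: power2_eq_square)

lemma symmetric_form_real:
  assumes "\<And>x y. cinner (D x) y = cinner x (D y)"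
  shows "cinner (D x) x = complex_of_real (Re (cinner (D x) x))"
proof -
  have "cinner (D x) x = cnj (cinner (D x) x)" using assms [of x x] by (metis cinner_commute)
  then show ?thesis by (simp add: complex_eq_iff)
qed

context
  fixes P G :: "'h::complex_hilbert \<Rightarrow> 'h"
  assumes PG: "partial_resolvent P G"
begin

lemma P_bounded: "P \<in> bounded_ops" and G_bounded: "G \<in> bounded_ops"
  and P_symmetric: "cinner (P x) y = cinner x (P y)" and P_idem: "P (P x) = P x"
  and G_P: "G (P x) = G x" and PG_symmetric: "cinner (P (G x)) y = cinner x (P (G y))"
  and G_norm: "(norm (G x))\<^sup>2 \<le> Re (cinner (P (G x)) x)"
  using PG by (auto simp: partial_resolvent_def)

lemma PG_real: "cinner (P (G x)) x = complex_of_real (Re (cinner (P (G x)) x))"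
  by (rule symmetric_form_real [of "\<lambda>x. P (G x)", OF PG_symmetric])

lemma P_norm: "(norm (P x))\<^sup>2 \<le> (norm x)\<^sup>2"
proof -
  have "0 \<le> (norm (x - P x))\<^sup>2" by simp
  also have "\<dots> = (norm x)\<^sup>2 - (norm (P x))\<^sup>2"
    by (simp add: Re_cinner_self [symmetric] cinner_simps P_symmetric P_idem)
  finally show ?thesis by simp
qed

text \<open>\<open>P - G\<close> plays the role of \<open>G\<close> for the inverse of
  \<open>S\<close>. The norm inequality is invariant under this exchange: expanding the square on
  the left and cancelling \<open>(norm (P x))\<^sup>2\<close> turns the new inequality into the old
  one.\<close>

lemma partial_resolvent_complement: "partial_resolvent P (\<lambda>x. P x - G x)"
  unfolding partial_resolvent_def
proof (intro conjI allI P_bounded bounded_ops_diff G_bounded P_symmetric P_idem)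
  fix x y
  show "P (P x) - G (P x) = P x - G x" by (simp add: P_idem G_P)
  show "cinner (P (P x - G x)) y = cinner x (P (P y - G y))"
    by (simp add: bounded_opsD [OF P_bounded] P_idem cinner_simps P_symmetric) (metis P_symmetric PG_symmetric)
  have *: "cinner (G x) (P x) = cinner (P (G x)) x" "cinner (P x) (G x) = cinner (P (G x)) x"
    using P_symmetric PG_symmetric by metis+
  have "(norm (P x - G x))\<^sup>2 = (norm (P x))\<^sup>2 - 2 * Re (cinner (P (G x)) x) + (norm (G x))\<^sup>2"
    by (simp add: Re_cinner_self [symmetric] cinner_simps *)
  moreover have "Re (cinner (P (P x - G x)) x) = (norm (P x))\<^sup>2 - Re (cinner (P (G x)) x)"
    using P_symmetric [of "P x" x]
    by (simp add: bounded_opsD [OF P_bounded] P_idem Re_cinner_self [symmetric] cinner_simps)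
  ultimately show "(norm (P x - G x))\<^sup>2 \<le> Re (cinner (P (P x - G x)) x)"
    using G_norm [of x] by linarith
qed

lemma adj_G_P: "adj G (P y) = P (G y)"
  by (rule cinner_ext) (metis cinner_adj' [OF G_bounded] P_symmetric PG_symmetric)

lemma P_adj_G: "P (adj G y) = adj G y"
  by (rule cinner_ext) (metis cinner_adj' [OF G_bounded] P_symmetric G_P)

section \<open>The Neumann series of a = P G\<close>

private definition E where "E x = x - P (G x)"

private lemma E_eta: "(\<lambda>x. x - P (G x)) = E"
  by (simp add: E_def fun_eq_iff)

private lemma bE: "E \<in> bounded_ops"
  unfolding E_eta [symmetric] by (intro bounded_ops_diff bounded_ops_ident bounded_ops_comp [OF P_bounded G_bounded])

text \<open>With a = P G, positivity of a is read off from the norm inequality for \<open>G\<close>,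
  and a \<le> P \<le> I from the one for the complement \<open>P - G\<close>.\<close>

private lemma E_contraction: "pos_contraction E"
  unfolding pos_contraction_def psd_op_def op_le_def
proof (intro conjI allI bE)
  fix x
  let ?q = "Re (cinner (P (G x)) x)"
  have q0: "?q \<ge> 0" using G_norm [of x] by (meson order_trans zero_le_power2)
  show "cinner (x - E x) x \<in> \<real>\<^sub>\<ge>\<^sub>0"
    using q0 by (simp add: E_def) (metis PG_real nonneg_Reals_of_real_iff)
  have "0 \<le> (norm (P x - G x))\<^sup>2" by simp
  also have "\<dots> \<le> Re (cinner (P (P x - G x)) x)"
    using partial_resolvent_complement unfolding partial_resolvent_def by blast
  also have "\<dots> = (norm (P x))\<^sup>2 - ?q"
    using P_symmetric [of "P x" x]
    by (simp add: bounded_opsD [OF P_bounded] P_idem Re_cinner_self [symmetric] cinner_simps)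
  finally have "?q \<le> (norm x)\<^sup>2" using P_norm [of x] by linarith
  moreover have "cinner (E x) x = complex_of_real ((norm x)\<^sup>2 - ?q)"
    by (subst of_real_diff, subst PG_real [symmetric]) (simp add: E_def cinner_simps cinner_self)
  ultimately show "cinner (E x) x \<in> \<real>\<^sub>\<ge>\<^sub>0" by (simp del: of_real_diff)
qed

text \<open>The partial sum that stands for the inverse of a = I - E; \<open>p_PG\<close> and
  \<open>PG_p\<close> are the two sides of the geometric sum identity.\<close>

private definition p where "p n x = (\<Sum>k<n. (E ^^ k) x)"

private lemma p_PG: "p n (P (G x)) = x - (E ^^ n) x" and PG_p: "P (G (p n x)) = x - (E ^^ n) x"
proof -
  have PGE: "P (G z) = z - E z" for z by (simp add: E_def)
  show "p n (P (G x)) = x - (E ^^ n) x"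
    by (induction n) (simp_all add: p_def PGE bounded_opsD [OF bounded_ops_funpow [OF bE]] funpow_swap1)
  show "P (G (p n x)) = x - (E ^^ n) x"
  proof (induction n)
    case (Suc n)
    have "P (G (p (Suc n) x)) = P (G (p n x)) + P (G ((E ^^ n) x))"
      by (simp add: p_def bounded_opsD [OF P_bounded] bounded_opsD [OF G_bounded])
    then show ?case unfolding Suc by (simp add: PGE)
  qed (simp add: p_def bounded_opsD [OF P_bounded] bounded_opsD [OF G_bounded])
qed

private lemma resolvent_approx_p: "resolvent_approx P G n x = G (p n (adj G x))"
  unfolding resolvent_approx_def E_eta p_def
  by (simp add: linear_sum [OF bounded_linear.linear [OF bounded_opsD(6) [OF G_bounded]]])

private lemma p_pos: "cinner (p n x) x \<in> \<real>\<^sub>\<ge>\<^sub>0"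
  unfolding p_def cinner_sum_left
  using psd_op_funpow [OF E_contraction]
  by (simp add: psd_op_def complex_nonneg_Reals_iff sum_nonneg)

text \<open>With a = P G the claim is \<open>p a p \<le> p\<close>. Indeed
  \<open>p a p = p - p (E ^^ n)\<close>, and the subtracted term is a sum of powers of
  \<open>E\<close>, all positive.\<close>

private lemma PG_p_le: "Re (cinner (P (G (p n x))) (p n x)) \<le> Re (cinner (p n x) x)"
proof -
  have "Re (cinner (p n x) ((E ^^ n) x)) \<ge> 0"
  proof -
    have "Re (cinner ((E ^^ k) x) ((E ^^ n) x)) \<ge> 0" for k
    proof -
      have "cinner ((E ^^ k) x) ((E ^^ n) x) = cinner ((E ^^ (n + k)) x) x"
        by (simp add: funpow_add funpow_symmetric [of E, OF pos_contraction_symmetric [OF E_contraction]])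
      then show ?thesis
        using psd_op_funpow [OF E_contraction, of "n + k"]
        by (simp add: psd_op_def complex_nonneg_Reals_iff)
    qed
    then show ?thesis unfolding p_def cinner_sum_left by (simp add: sum_nonneg)
  qed
  moreover have "Re (cinner x (p n x)) = Re (cinner (p n x) x)"
    by (subst cinner_commute) simp
  moreover have "Re (cinner ((E ^^ n) x) (p n x)) = Re (cinner (p n x) ((E ^^ n) x))"
    by (subst cinner_commute) simp
  ultimately show ?thesis by (simp add: PG_p cinner_simps)
qed

private lemma approx_form: "cinner (resolvent_approx P G n x) x = cinner (p n (adj G x)) (adj G x)"
  by (simp add: resolvent_approx_p cinner_adj [OF G_bounded])

text \<open>With \<open>g = adj G x\<close>, the form of the approximant at \<open>x\<close> is
  \<open>q = cinner (p n g) g = cinner (G (p n g)) x\<close>. Cauchy-Schwarz bounds its square by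
  \<open>(norm (G (p n g)))\<^sup>2 * (norm x)\<^sup>2\<close>, where the first factor is at most
  \<open>q\<close> by \<open>G_norm\<close> and \<open>PG_p_le\<close>; one \<open>q\<close>
  cancels.\<close>

private lemma resolvent_approx_le_id: "op_le (resolvent_approx P G n) (\<lambda>x. x)"
  unfolding op_le_def
proof
  fix x
  define g where "g = adj G x"
  obtain q where q: "q \<ge> 0" "cinner (p n g) g = complex_of_real q"
    using p_pos [of n g] nonneg_Reals_cases by metis
  have "q\<^sup>2 \<le> (cmod (cinner (G (p n g)) x))\<^sup>2"
    using q by (simp add: g_def cinner_adj [OF G_bounded])
  also have "\<dots> \<le> (norm (G (p n g)) * norm x)\<^sup>2"
    by (intro power_mono Cauchy_Schwarz) simp
  also have "\<dots> = (norm (G (p n g)))\<^sup>2 * (norm x)\<^sup>2" by (simp add: power_mult_distrib)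
  also have "\<dots> \<le> q * (norm x)\<^sup>2"
    using G_norm [of "p n g"] PG_p_le [of n g] q by (intro mult_right_mono) auto
  finally have "q \<le> (norm x)\<^sup>2" by (rule sq_le_mult_imp_le) (use q in auto)
  moreover have "cinner (x - resolvent_approx P G n x) x = complex_of_real ((norm x)\<^sup>2 - q)"
    unfolding cinner_diff_left approx_form g_def [symmetric] using q by (simp add: cinner_self)
  ultimately show "cinner (x - resolvent_approx P G n x) x \<in> \<real>\<^sub>\<ge>\<^sub>0" by (simp del: of_real_diff)
qed

lemma resolvent_approx_bounded: "resolvent_approx P G n \<in> bounded_ops"
proof -
  have "resolvent_approx P G n = (\<lambda>x. \<Sum>k<n. G ((E ^^ k) (adj G x)))"
    by (simp add: fun_eq_iff resolvent_approx_def E_eta)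
  then show ?thesis
    by (simp add: bounded_ops_sum bounded_ops_comp [OF G_bounded] bounded_ops_comp [OF bounded_ops_funpow [OF bE] bounded_ops_adj [OF G_bounded]])
qed

lemma resolvent_approx_symmetric:
  "cinner (resolvent_approx P G n x) y = cinner x (resolvent_approx P G n y)"
proof (rule real_form_symmetric [OF resolvent_approx_bounded])
  show "cinner (resolvent_approx P G n x) x \<in> \<real>" for x
    unfolding approx_form using p_pos nonneg_Reals_Real by blast
qed

lemma resolvent_approx_increasing: "op_le (resolvent_approx P G n) (resolvent_approx P G (Suc n))"
  unfolding op_le_def
proof
  fix x
  have "cinner ((E ^^ n) (adj G x)) (adj G x) \<in> \<real>\<^sub>\<ge>\<^sub>0"
    using psd_op_funpow [OF E_contraction] by (simp add: psd_op_def)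
  then show "cinner (resolvent_approx P G (Suc n) x - resolvent_approx P G n x) x \<in> \<real>\<^sub>\<ge>\<^sub>0"
    by (simp add: resolvent_approx_def E_eta cinner_adj [OF G_bounded])
qed

text \<open>\<open>(E ^^ n) x\<close> itself need not tend to 0, since \<open>E\<close> is the
  identity on the orthogonal complement of the range of \<open>P\<close>. By \<open>G_norm\<close>,
  however, the squared norm after \<open>G\<close> is at most a difference of consecutive terms of
  the decreasing nonnegative sequence \<open>s\<close>.\<close>

private lemma G_funpow_tendsto_0: "(\<lambda>n. G ((E ^^ n) x)) \<longlonglongrightarrow> 0"
proof -
  define s where "s k = Re (cinner ((E ^^ k) x) x)" for k
  have dec: "s (Suc k) \<le> s k" for k
    using funpow_decreasing [OF E_contraction, of k]
    by (simp add: op_le_def s_def complex_nonneg_Reals_iff cinner_simps)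
  have pos: "s k \<ge> 0" for k
    using psd_op_funpow [OF E_contraction, of k] by (simp add: psd_op_def s_def complex_nonneg_Reals_iff)
  have "decseq s" using dec by (simp add: decseq_Suc_iff)
  then obtain l where "s \<longlonglongrightarrow> l" using decseq_convergent [of s 0] pos by blast
  then have "(\<lambda>n. s (2 * n)) \<longlonglongrightarrow> l" "(\<lambda>n. s (Suc (2 * n))) \<longlonglongrightarrow> l"
    using LIMSEQ_subseq_LIMSEQ [of s l "\<lambda>n. 2 * n"] LIMSEQ_subseq_LIMSEQ [of s l "\<lambda>n. Suc (2 * n)"]
    by (auto simp: strict_mono_def o_def)
  from tendsto_diff [OF this] have lim: "(\<lambda>n. s (2 * n) - s (Suc (2 * n))) \<longlonglongrightarrow> 0" by simp
  have "(norm (G ((E ^^ n) x)))\<^sup>2 \<le> s (2 * n) - s (Suc (2 * n))" for n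
  proof -
    have "(norm (G ((E ^^ n) x)))\<^sup>2 \<le> Re (cinner (P (G ((E ^^ n) x))) ((E ^^ n) x))" by (rule G_norm)
    also have "P (G ((E ^^ n) x)) = (E ^^ n) x - (E ^^ n) (E x)"
      unfolding funpow_swap1 [of E, symmetric] by (simp add: E_def)
    also have "Re (cinner ((E ^^ n) x - (E ^^ n) (E x)) ((E ^^ n) x)) = s (2 * n) - s (Suc (2 * n))"
      by (simp add: s_def cinner_simps mult_2 funpow_add funpow_swap1 bounded_opsD(3) [OF bounded_ops_funpow [OF bE]]
          funpow_symmetric [of E, OF pos_contraction_symmetric [OF E_contraction], symmetric])
    finally show ?thesis .
  qed
  then have "(\<lambda>n. (norm (G ((E ^^ n) x)))\<^sup>2) \<longlonglongrightarrow> 0"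
    by (intro tendsto_sandwich [OF _ _ tendsto_const lim] always_eventually) auto
  then have "(\<lambda>n. sqrt ((norm (G ((E ^^ n) x)))\<^sup>2)) \<longlonglongrightarrow> sqrt 0" by (rule tendsto_real_sqrt)
  then show ?thesis by (simp add: tendsto_norm_zero_iff)
qed

text \<open>Positivity of \<open>R\<close> is tested at \<open>x - y\<close> with
  \<open>y = p n (adj G x)\<close>. Since \<open>y\<close> lies in the range of \<open>P\<close>,
  the value \<open>R y = G y\<close> is prescribed, both cross terms equal \<open>q\<close>, and the
  form of \<open>R\<close> at \<open>x\<close> is at least \<open>2 q - q\<close>, where
  \<open>q\<close> is the form of the approximant at \<open>x\<close>.\<close>

private lemma resolvent_approx_le:
  assumes R: "psd_op R" and RP: "\<And>x. R (P x) = G x"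
  shows "op_le (resolvent_approx P G n) R"
  unfolding op_le_def
proof
  fix x
  define g where "g = adj G x"
  define y where "y = p n g"
  have bR: "R \<in> bounded_ops" using R by (simp add: psd_op_def)
  obtain q where q: "cinner y g = complex_of_real q"
    using p_pos [of n g] nonneg_Reals_cases unfolding y_def by metis
  have "P ((E ^^ k) g) = (E ^^ k) g" for k
  proof (induction k)
    case 0
    show ?case by (simp add: g_def P_adj_G)
  next
    case (Suc k)
    then show ?case by (simp add: E_def bounded_opsD [OF P_bounded] P_idem)
  qed
  then have "P y = y"
    by (simp add: y_def p_def linear_sum [OF bounded_linear.linear [OF bounded_opsD(6) [OF P_bounded]]])
  then have Ry: "R y = G y" using RP by metis
  have 1: "cinner (R y) x = complex_of_real q"
    using q by (simp add: Ry cinner_adj [OF G_bounded] g_def)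
  have 2: "cinner (R x) y = complex_of_real q"
    using 1 by (metis psd_op_symmetric [OF R] cinner_commute complex_cnj_complex_of_real)
  have "cinner (R y) y = cinner (P (G y)) y" using \<open>P y = y\<close> P_symmetric by (metis Ry)
  then have 3: "Re (cinner (R y) y) \<le> q" using PG_p_le [of n g] q by (simp add: y_def)
  have "0 \<le> Re (cinner (R (x - y)) (x - y))"
    using R by (simp add: psd_op_def complex_nonneg_Reals_iff)
  also have "\<dots> = Re (cinner (R x) x) - 2 * q + Re (cinner (R y) y)"
    by (simp add: bounded_opsD [OF bR] cinner_simps 1 2)
  finally have "q \<le> Re (cinner (R x) x)" using 3 by simp
  moreover have "Im (cinner (R x) x) = 0" using R by (simp add: psd_op_def complex_nonneg_Reals_iff)
  ultimately show "cinner (R x - resolvent_approx P G n x) x \<in> \<real>\<^sub>\<ge>\<^sub>0"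
    unfolding cinner_diff_left approx_form g_def [symmetric] y_def [symmetric]
    using q by (simp add: complex_nonneg_Reals_iff complex_eq_iff)
qed

text \<open>At \<open>P x\<close> the approximant misses \<open>G x\<close> by exactly
  \<open>G ((E ^^ n) x)\<close>, so the equation \<open>L (P x) = G x\<close> appears only in the
  limit. The bound by the identity is inherited from the approximants; it makes the least positive
  solution a resolvent.\<close>

theorem least_resolvent:
  obtains L where "L \<in> resolvents P G" "\<And>x. (\<lambda>n. resolvent_approx P G n x) \<longlonglongrightarrow> L x"
    "\<And>R. psd_op R \<Longrightarrow> (\<And>x. R (P x) = G x) \<Longrightarrow> op_le L R"
proof -
  obtain L where bL: "L \<in> bounded_ops" and lim: "\<And>x. (\<lambda>n. resolvent_approx P G n x) \<longlonglongrightarrow> L x"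
    using monotone_strong_limit [of "resolvent_approx P G" "\<lambda>x. x", OF resolvent_approx_bounded
        resolvent_approx_increasing bounded_ops_ident resolvent_approx_le_id] by metis
  have "op_le (resolvent_approx P G 0) L"
    using lim resolvent_approx_increasing by (rule strong_limit_op_le)
  then have "psd_op L"
    by (simp add: psd_op_def bL op_le_def resolvent_approx_def)
  moreover have "op_le L (\<lambda>x. x)"
    using lim resolvent_approx_le_id by (rule op_le_strong_limit)
  moreover have "L (P x) = G x" for x
  proof -
    have "resolvent_approx P G n (P x) = G x - G ((E ^^ n) x)" for n
      by (simp add: resolvent_approx_p adj_G_P p_PG bounded_opsD [OF G_bounded])
    then have "(\<lambda>n. resolvent_approx P G n (P x)) \<longlonglongrightarrow> G x - 0"
      using tendsto_diff [OF tendsto_const G_funpow_tendsto_0, of "G x" x] by simp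
    then show ?thesis using LIMSEQ_unique [OF lim [of "P x"]] by simp
  qed
  moreover have "op_le L R" if "psd_op R" "\<And>x. R (P x) = G x" for R
    using lim resolvent_approx_le [OF that] by (rule op_le_strong_limit)
  ultimately show ?thesis
    using lim by (intro that [of L]) (auto simp: resolvents_def pos_contraction_def)
qed

lemma resolvent_complement:
  assumes "R \<in> resolvents P G"
  shows "(\<lambda>x. x - R x) \<in> resolvents P (\<lambda>x. P x - G x)"
  using assms by (auto simp: resolvents_def pos_contraction_def psd_op_def op_le_def
      bounded_ops_diff bounded_ops_ident)

end

section \<open>Positive self-adjoint extensions and their resolvents\<close>

lemma op_quotient_unbounded_op:
  assumes A: "A \<in> bounded_ops" and B: "B \<in> bounded_ops" and null: "null_space B \<subseteq> null_space A"
  shows "unbounded_op (op_quotient A B)"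
  unfolding unbounded_op_def
proof (intro conjI allI impI)
  have mem: "(B x, A x) \<in> op_quotient A B" for x by (auto simp: op_quotient_def)
  show "(0, 0) \<in> op_quotient A B" using mem [of 0] by (simp add: bounded_opsD [OF A] bounded_opsD [OF B])
  show "(x + x', y + y') \<in> op_quotient A B" if "(x, y) \<in> op_quotient A B \<and> (x', y') \<in> op_quotient A B" for x y x' y'
    using that mem by (auto simp: op_quotient_def bounded_opsD(1) [OF A, symmetric] bounded_opsD(1) [OF B, symmetric])
  show "(c *\<^sub>C x, c *\<^sub>C y) \<in> op_quotient A B" if "(x, y) \<in> op_quotient A B" for c x y
    using that mem by (auto simp: op_quotient_def bounded_opsD(2) [OF A, symmetric] bounded_opsD(2) [OF B, symmetric])
  have "A x = A y" if "B x = B y" for x y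
  proof -
    have "x - y \<in> null_space B" using that by (simp add: null_space_def bounded_opsD [OF B])
    then have "A (x - y) = 0" using null by (auto simp: null_space_def)
    then show ?thesis by (simp add: bounded_opsD [OF A])
  qed
  then show "single_valued (op_quotient A B)"
    unfolding op_quotient_def by (intro single_valuedI) fast
qed

lemma unbounded_op_diff:
  assumes "unbounded_op T" "(x, y) \<in> T" "(x', y') \<in> T"
  shows "(x - x', y - y') \<in> T"
proof -
  have "((-1) *\<^sub>C x', (-1) *\<^sub>C y') \<in> T" using assms unfolding unbounded_op_def by blast
  then have "(x + (-1) *\<^sub>C x', y + (-1) *\<^sub>C y') \<in> T" using assms unfolding unbounded_op_def by blast
  then show ?thesis by simp
qed

lemma positive_op_norm:
  assumes "positive_op T" "(x, y) \<in> T"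
  shows "(norm x)\<^sup>2 + (norm y)\<^sup>2 \<le> (norm (x + y))\<^sup>2"
proof -
  have "Re (cinner y x) \<ge> 0" using assms by (auto simp: positive_op_def complex_nonneg_Reals_iff)
  moreover have "Re (cinner x y) = Re (cinner y x)" by (subst cinner_commute) simp
  ultimately show ?thesis by (simp add: Re_cinner_self [symmetric] cinner_simps)
qed

text \<open>By positivity the sum \<open>x + y\<close> controls both \<open>x\<close> and
  \<open>y\<close>, so a convergent sequence of sums comes from a Cauchy sequence in the
  graph.\<close>

lemma closed_range_plus_id:
  fixes T :: "('h::complex_hilbert \<times> 'h) set"
  assumes T: "unbounded_op T" "positive_op T" "closed T"
  shows "closed ((\<lambda>(x, y). x + y) ` T)"
  unfolding closed_sequential_limits
proof (intro allI impI)
  fix f v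
  assume *: "(\<forall>n. f n \<in> (\<lambda>(x, y). x + y) ` T) \<and> f \<longlonglongrightarrow> v"
  then have v: "f \<longlonglongrightarrow> v" by blast
  have "\<exists>x y. (x, y) \<in> T \<and> f n = x + y" for n
  proof -
    obtain q where "q \<in> T" "f n = (case q of (x, y) \<Rightarrow> x + y)" using * by blast
    then show ?thesis by (cases q) auto
  qed
  then obtain g h where gh: "\<And>n. (g n, h n) \<in> T" "\<And>n. f n = g n + h n" by metis
  have C: "Cauchy f" using v by (rule LIMSEQ_imp_Cauchy)
  have le: "norm (g m - g n) \<le> norm (f m - f n)" "norm (h m - h n) \<le> norm (f m - f n)" for m n
  proof -
    have "(norm (g m - g n))\<^sup>2 + (norm (h m - h n))\<^sup>2 \<le> (norm (f m - f n))\<^sup>2"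
      using positive_op_norm [OF T(2) unbounded_op_diff [OF T(1) gh(1) gh(1)], of m n]
      by (simp add: gh add_diff_add)
    then have "(norm (g m - g n))\<^sup>2 \<le> (norm (f m - f n))\<^sup>2" "(norm (h m - h n))\<^sup>2 \<le> (norm (f m - f n))\<^sup>2"
      using zero_le_power2 [of "norm (g m - g n)"] zero_le_power2 [of "norm (h m - h n)"] by linarith+
    then show "norm (g m - g n) \<le> norm (f m - f n)" "norm (h m - h n) \<le> norm (f m - f n)"
      by (meson power2_le_imp_le norm_ge_zero)+
  qed
  have "Cauchy u" if u: "\<And>m n. norm (u m - u n) \<le> norm (f m - f n)" for u :: "nat \<Rightarrow> 'h"
  proof (rule metric_CauchyI)
    fix e :: real assume "e > 0"
    then obtain k where "\<forall>m\<ge>k. \<forall>n\<ge>k. dist (f m) (f n) < e" using metric_CauchyD [OF C] by blast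
    then show "\<exists>k. \<forall>m\<ge>k. \<forall>n\<ge>k. dist (u m) (u n) < e"
      using u unfolding dist_norm by (metis le_less_trans)
  qed
  then have "Cauchy g" "Cauchy h" using le by blast+
  then obtain x y where xy: "g \<longlonglongrightarrow> x" "h \<longlonglongrightarrow> y" using Cauchy_convergent convergentD by metis
  then have "(\<lambda>n. (g n, h n)) \<longlonglongrightarrow> (x, y)" by (rule tendsto_Pair)
  then have "(x, y) \<in> T" using closed_sequentially [OF T(3), of "\<lambda>n. (g n, h n)"] gh(1) by blast
  moreover have "v = x + y"
    using LIMSEQ_unique [OF v] tendsto_add [OF xy] by (simp add: gh(2) [abs_def])
  ultimately show "v \<in> (\<lambda>(x, y). x + y) ` T" by auto
qed

text \<open>The operator with resolvent \<open>R = (T + I)\<inverse>\<close>.\<close>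

definition op_of_resolvent :: "('h::complex_hilbert \<Rightarrow> 'h) \<Rightarrow> ('h \<times> 'h) set"
  where "op_of_resolvent R = op_quotient (\<lambda>x. x - R x) R"

text \<open>Through this equation, extending \<open>S\<close>, evaluating
  \<open>inverse_plus_id\<close> and computing the adjoint all become equations for
  \<open>R\<close>.\<close>

lemma mem_op_of_resolvent: "(u, v) \<in> op_of_resolvent R \<longleftrightarrow> u = R (u + v)"
  unfolding op_of_resolvent_def op_quotient_def
proof safe
  fix x
  show "R x = R (R x + (x - R x))" by simp
next
  assume "u = R (u + v)"
  then show "\<exists>x. (u, v) = (R x, x - R x) \<and> True"
    by (intro exI [of _ "u + v"]) (simp add: algebra_simps flip: \<open>u = R (u + v)\<close>)
qed

lemma inverse_plus_id_op_of_resolvent [simp]: "inverse_plus_id (op_of_resolvent R) = R"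
  by (simp add: fun_eq_iff inverse_plus_id_def mem_op_of_resolvent)

lemma symmetric_dense_range_injective:
  fixes R :: "'h::complex_hilbert \<Rightarrow> 'h"
  assumes "\<And>x y. cinner (R x) y = cinner x (R y)" and "closure (range R) = UNIV"
  shows "null_space R \<subseteq> {0}"
proof
  fix x assume "x \<in> null_space R"
  then have "cinner x l = 0" if "l \<in> range R" for l
    using that assms(1) [of x] by (auto simp: null_space_def)
  then show "x \<in> {0}" using orthogonal_dense [OF assms(2)] by blast
qed

lemma closed_op_adjoint: "closed (op_adjoint T)"
proof -
  have "op_adjoint T = (\<Inter>(x, y)\<in>T. {p. cinner y (fst p) = cinner x (snd p)})"
    by (auto simp: op_adjoint_def)
  moreover have "closed {p. cinner y (fst p) = cinner x (snd p)}" for x y :: 'a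
    by (intro closed_Collect_eq continuous_on_cinner continuous_on_const continuous_on_fst continuous_on_snd continuous_on_id)
  ultimately show ?thesis by auto
qed

text \<open>The range of \<open>T + I\<close> is closed. If \<open>z\<close> is orthogonal to it,
  then \<open>(z, - z)\<close> belongs to the adjoint, hence to \<open>T\<close>, and positivity
  gives \<open>- |z|^2 \<ge> 0\<close>. So \<open>T + I\<close> is onto, and
  \<open>positive_op_norm\<close> makes its inverse single-valued and contractive.\<close>

lemma psa_op_resolvent:
  fixes T :: "('h::complex_hilbert \<times> 'h) set"
  assumes sa: "self_adjoint_op T" and pos: "positive_op T"
  obtains R where "pos_contraction R" "T = op_of_resolvent R"
proof -
  have T: "unbounded_op T" "op_adjoint T = T" using sa by (auto simp: self_adjoint_op_def)
  then have cT: "closed T" using closed_op_adjoint [of T] by simp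
  define V where "V = (\<lambda>(x, y). x + y) ` T"
  have cV: "closed V" unfolding V_def by (rule closed_range_plus_id [OF T(1) pos cT])
  have subV: "csubspace V"
    unfolding csubspace_def
  proof (intro conjI ballI allI)
    have "(0, 0) \<in> T" using T(1) by (simp add: unbounded_op_def)
    then show "0 \<in> V" by (force simp: V_def)
  next
    fix v w assume "v \<in> V" "w \<in> V"
    then obtain x y x' y' where "(x, y) \<in> T" "(x', y') \<in> T" and eq: "v = x + y" "w = x' + y'" by (auto simp: V_def)
    then have "(x + x', y + y') \<in> T" using T(1) unfolding unbounded_op_def by blast
    then show "v + w \<in> V" by (force simp: V_def eq)
  next
    fix c v assume "v \<in> V"
    then obtain x y where "(x, y) \<in> T" and eq: "v = x + y" by (auto simp: V_def)
    then have "(c *\<^sub>C x, c *\<^sub>C y) \<in> T" using T(1) unfolding unbounded_op_def by blast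
    then show "c *\<^sub>C v \<in> V" by (force simp: V_def eq scaleC_add_right)
  qed
  have "closure V = UNIV"
  proof (rule dense_of_orthogonal [OF subV])
    fix z assume z: "\<And>l. l \<in> V \<Longrightarrow> cinner z l = 0"
    have "cinner y z = cinner x (- z)" if "(x, y) \<in> T" for x y
    proof -
      have "x + y \<in> V" using that by (force simp: V_def)
      then have "cinner (x + y) z = 0" using z by (metis cinner_commute complex_cnj_zero)
      then show ?thesis by (simp add: cinner_simps add_eq_0_iff2)
    qed
    then have "(z, - z) \<in> op_adjoint T" by (auto simp: op_adjoint_def)
    then have "cinner (- z) z \<in> \<real>\<^sub>\<ge>\<^sub>0" using pos T(2) by (auto simp: positive_op_def)
    then have "(norm z)\<^sup>2 \<le> 0"
      by (simp add: cinner_simps complex_nonneg_Reals_iff Re_cinner_self)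
    then show "z = 0" by simp
  qed
  then have V: "V = UNIV" using cV by simp
  have ex: "\<exists>x. (x, z - x) \<in> T" for z
  proof -
    have "z \<in> V" using V by simp
    then obtain x y where "(x, y) \<in> T" "z = x + y" by (auto simp: V_def)
    then show ?thesis by (intro exI [of _ x]) simp
  qed
  then obtain R where R: "\<And>z. (R z, z - R z) \<in> T" by metis
  have uniq: "R (x + y) = x" if "(x, y) \<in> T" for x y
  proof -
    have "(norm (R (x + y) - x))\<^sup>2 + (norm (x + y - R (x + y) - y))\<^sup>2 \<le> 0"
      using positive_op_norm [OF pos unbounded_op_diff [OF T(1) R that], of "x + y"] by simp
    then show ?thesis by (simp add: sum_power2_le_zero_iff)
  qed
  have TR: "T = op_of_resolvent R"
  proof -
    have "(u, v) \<in> T \<longleftrightarrow> (u, v) \<in> op_of_resolvent R" for u v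
      unfolding mem_op_of_resolvent using uniq [of u v] R [of "u + v"] by auto
    then show ?thesis by auto
  qed
  have bR: "R \<in> bounded_ops"
  proof (rule bounded_opsI [where K = 1])
    fix x y c
    have "(R x + R y, (x - R x) + (y - R y)) \<in> T"
      using T(1) R unfolding unbounded_op_def by blast
    moreover have "R x + R y + ((x - R x) + (y - R y)) = x + y" by simp
    ultimately show "R (x + y) = R x + R y" using uniq by metis
    have "(c *\<^sub>C R x, c *\<^sub>C (x - R x)) \<in> T"
      using T(1) R unfolding unbounded_op_def by blast
    moreover have "c *\<^sub>C R x + c *\<^sub>C (x - R x) = c *\<^sub>C x" by (simp add: scaleC_diff_right)
    ultimately show "R (c *\<^sub>C x) = c *\<^sub>C R x" using uniq by metis
    have "(norm (R x))\<^sup>2 \<le> (norm x)\<^sup>2"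
    proof -
      have "(norm (R x))\<^sup>2 + (norm (x - R x))\<^sup>2 \<le> (norm x)\<^sup>2"
        using positive_op_norm [OF pos R, of x] by simp
      then show ?thesis using zero_le_power2 [of "norm (x - R x)"] by linarith
    qed
    then show "norm (R x) \<le> norm x * 1" by simp
  qed
  have form: "cinner (z - R z) (R z) \<in> \<real>\<^sub>\<ge>\<^sub>0" for z
    using pos R [of z] unfolding positive_op_def by blast
  then have form': "cinner (R z) (z - R z) \<in> \<real>\<^sub>\<ge>\<^sub>0" for z
    by (subst cinner_commute) (simp add: complex_nonneg_Reals_iff)
  have "cinner (R z) z \<in> \<real>\<^sub>\<ge>\<^sub>0" for z
  proof -
    have "cinner (R z) z = cinner (R z) (z - R z) + complex_of_real ((norm (R z))\<^sup>2)"
      by (simp only: cinner_self [symmetric] cinner_simps) simp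
    then show ?thesis using form' [of z] by (simp del: of_real_power)
  qed
  moreover have "cinner (z - R z) z \<in> \<real>\<^sub>\<ge>\<^sub>0" for z
  proof -
    have "cinner (z - R z) z = cinner (z - R z) (R z) + complex_of_real ((norm (z - R z))\<^sup>2)"
      by (simp only: cinner_self [symmetric] cinner_simps) simp
    then show ?thesis using form [of z] by (simp del: of_real_power)
  qed
  ultimately have "pos_contraction R"
    by (simp add: pos_contraction_def psd_op_def op_le_def bR)
  then show ?thesis using TR by (rule that)
qed

text \<open>By symmetry of \<open>R\<close>, a pair \<open>(u, v)\<close> lies in the adjoint
  exactly if \<open>u - R (u + v)\<close> is orthogonal to everything, which is membership in the
  graph itself. Positivity of the operator is the inequality \<open>pos_contraction_norm_le\<close>
  for \<open>R\<close>.\<close>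

lemma op_of_resolvent_psa:
  fixes R :: "'h::complex_hilbert \<Rightarrow> 'h"
  assumes R: "pos_contraction R" and dense: "closure (range R) = UNIV"
  shows "self_adjoint_op (op_of_resolvent R)" "positive_op (op_of_resolvent R)"
proof -
  have bR: "R \<in> bounded_ops" using R by (simp add: pos_contraction_def psd_op_def)
  note sym = pos_contraction_symmetric [OF R]
  have "null_space R \<subseteq> {0}"
    using sym dense by (rule symmetric_dense_range_injective)
  moreover have "0 \<in> null_space (\<lambda>x. x - R x)"
    by (simp add: null_space_def bounded_opsD(5) [OF bR])
  ultimately have "null_space R \<subseteq> null_space (\<lambda>x. x - R x)" by blast
  then have "unbounded_op (op_of_resolvent R)"
    unfolding op_of_resolvent_def by (intro op_quotient_unbounded_op bounded_ops_diff bounded_ops_ident bR)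
  moreover have "densely_defined (op_of_resolvent R)"
  proof -
    have "Domain (op_of_resolvent R) = range R" by (auto simp: op_of_resolvent_def op_quotient_def Domain_iff)
    then show ?thesis using dense by (simp add: densely_defined_def)
  qed
  moreover have "op_adjoint (op_of_resolvent R) = op_of_resolvent R"
  proof -
    have "(u, v) \<in> op_adjoint (op_of_resolvent R) \<longleftrightarrow> (u, v) \<in> op_of_resolvent R" for u v
    proof -
      have "(u, v) \<in> op_adjoint (op_of_resolvent R) \<longleftrightarrow> (\<forall>x. cinner (x - R x) u = cinner (R x) v)"
        by (auto simp: op_adjoint_def op_of_resolvent_def op_quotient_def)
      also have "\<dots> \<longleftrightarrow> (\<forall>x. cinner x (u - R (u + v)) = 0)"
        by (simp add: cinner_simps sym bounded_opsD [OF bR] diff_eq_eq add.commute)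
      also have "\<dots> \<longleftrightarrow> u = R (u + v)"
        by (metis cinner_eq_zero_iff cinner_zero_right right_minus_eq)
      finally show ?thesis by (simp add: mem_op_of_resolvent)
    qed
    then show ?thesis by auto
  qed
  ultimately show "self_adjoint_op (op_of_resolvent R)" by (simp add: self_adjoint_op_def)
  have "cinner (x - R x) (R x) \<in> \<real>\<^sub>\<ge>\<^sub>0" for x
  proof -
    have "cinner (R x) x \<in> \<real>\<^sub>\<ge>\<^sub>0" using R by (simp add: pos_contraction_def psd_op_def)
    moreover have "cinner (x - R x) (R x) = cinner (R x) x - complex_of_real ((norm (R x))\<^sup>2)"
      by (simp add: cinner_simps cinner_self sym del: of_real_power)
    ultimately show ?thesis
      using pos_contraction_norm_le [OF R, of x] by (simp add: complex_nonneg_Reals_iff del: of_real_power)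
  qed
  then show "positive_op (op_of_resolvent R)"
    by (auto simp: positive_op_def op_of_resolvent_def op_quotient_def)
qed

text \<open>Since \<open>R P = G\<close>, the range of \<open>R\<close> contains that of
  \<open>G\<close>. Density of the latter therefore makes every member of
  \<open>resolvents P G\<close> the resolvent of a densely defined, single-valued operator.\<close>

lemma psa_extensions_resolvents:
  fixes P G :: "'h::complex_hilbert \<Rightarrow> 'h"
  assumes dense: "closure (range G) = UNIV"
  shows "psa_extensions (op_quotient (\<lambda>x. P x - G x) G) = op_of_resolvent ` resolvents P G"
proof -
  have sub: "op_quotient (\<lambda>x. P x - G x) G \<subseteq> op_of_resolvent R \<longleftrightarrow> (\<forall>x. R (P x) = G x)" for R
  proof -
    have "op_quotient (\<lambda>x. P x - G x) G \<subseteq> op_of_resolvent R \<longleftrightarrow> (\<forall>x. (G x, P x - G x) \<in> op_of_resolvent R)"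
      by (auto simp: op_quotient_def)
    also have "\<dots> \<longleftrightarrow> (\<forall>x. G x = R (P x))" by (simp add: mem_op_of_resolvent)
    finally show ?thesis by metis
  qed
  show ?thesis
  proof
    show "psa_extensions (op_quotient (\<lambda>x. P x - G x) G) \<subseteq> op_of_resolvent ` resolvents P G"
    proof
      fix T assume T: "T \<in> psa_extensions (op_quotient (\<lambda>x. P x - G x) G)"
      then obtain R where "pos_contraction R" "T = op_of_resolvent R"
        using psa_op_resolvent unfolding psa_extensions_def by (metis (no_types, lifting) mem_Collect_eq)
      then show "T \<in> op_of_resolvent ` resolvents P G"
        using T sub by (auto simp: psa_extensions_def resolvents_def)
    qed
  next
    show "op_of_resolvent ` resolvents P G \<subseteq> psa_extensions (op_quotient (\<lambda>x. P x - G x) G)"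
    proof
      fix T assume "T \<in> op_of_resolvent ` resolvents P G"
      then obtain R where R: "R \<in> resolvents P G" "T = op_of_resolvent R" by blast
      then have "range G \<subseteq> range R" by (auto simp: resolvents_def) (metis rangeI)
      then have "closure (range R) = UNIV" using dense closure_mono by blast
      with R show "T \<in> psa_extensions (op_quotient (\<lambda>x. P x - G x) G)"
        using op_of_resolvent_psa sub by (auto simp: psa_extensions_def resolvents_def)
    qed
  qed
qed

lemma resolvents_bounded: "R \<in> resolvents P G \<Longrightarrow> R \<in> bounded_ops"
  by (simp add: resolvents_def pos_contraction_def psd_op_def)

text \<open>\<open>op_le_antisym\<close> supplies the uniqueness that the definite description in
  \<open>friedrichs_ext\<close> asks for.\<close>

lemma friedrichs_ext_resolvent:
  assumes dense: "closure (range G) = UNIV" and L: "L \<in> resolvents P G"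
    and least: "\<And>R. R \<in> resolvents P G \<Longrightarrow> op_le L R"
  shows "friedrichs_ext (op_quotient (\<lambda>x. P x - G x) G) = op_of_resolvent L"
  unfolding friedrichs_ext_def psa_extensions_resolvents [OF dense]
proof (rule the_equality)
  fix T
  assume T: "T \<in> op_of_resolvent ` resolvents P G \<and> (\<forall>T'\<in>op_of_resolvent ` resolvents P G. ext_le T' T)"
  then obtain R where R: "R \<in> resolvents P G" "T = op_of_resolvent R" by blast
  then have "op_le R L" using T L by (auto simp: ext_le_def)
  then have "R = L" using least R(1) L by (intro op_le_antisym resolvents_bounded)
  then show "T = op_of_resolvent L" by (simp add: R)
qed (use L least in \<open>auto simp: ext_le_def\<close>)

lemma krein_ext_resolvent:
  assumes dense: "closure (range G) = UNIV" and L: "L \<in> resolvents P G"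
    and greatest: "\<And>R. R \<in> resolvents P G \<Longrightarrow> op_le R L"
  shows "krein_ext (op_quotient (\<lambda>x. P x - G x) G) = op_of_resolvent L"
  unfolding krein_ext_def psa_extensions_resolvents [OF dense]
proof (rule the_equality)
  fix T
  assume T: "T \<in> op_of_resolvent ` resolvents P G \<and> (\<forall>T'\<in>op_of_resolvent ` resolvents P G. ext_le T T')"
  then obtain R where R: "R \<in> resolvents P G" "T = op_of_resolvent R" by blast
  then have "op_le L R" using T L by (auto simp: ext_le_def)
  then have "R = L" using greatest R(1) L by (intro op_le_antisym resolvents_bounded)
  then show "T = op_of_resolvent L" by (simp add: R)
qed (use L greatest in \<open>auto simp: ext_le_def\<close>)

section \<open>Extremal extensions and normal homomorphisms\<close>

context vn_algebra
begin

text \<open>Every \<open>U\<close> in the commutant preserves the range of \<open>C\<close>, and so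
  does \<open>adj U\<close>. Hence \<open>U (P x)\<close> lies in the range and
  \<open>U x - U (P x)\<close> is orthogonal to it, which characterizes
  \<open>P (U x)\<close>.\<close>

lemma range_projection:
  assumes C: "C \<in> M" and "closed (range C)"
  obtains P where "P \<in> M" "\<And>x. P x \<in> range C" "\<And>x. P (C x) = C x"
    "\<And>x y. cinner (P x) y = cinner x (P y)"
proof -
  note bC = bounded [OF C]
  have sub: "csubspace (range C)" by (rule csubspace_range [OF bC])
  have "\<exists>p\<in>range C. \<forall>l\<in>range C. cinner (x - p) l = 0" for x
    by (rule projection_theorem [OF sub assms(2), of x]) blast
  then obtain P where P: "\<And>x. P x \<in> range C" "\<And>x l. l \<in> range C \<Longrightarrow> cinner (x - P x) l = 0"
    by metis
  have uniq: "P x = p" if "p \<in> range C" "\<And>l. l \<in> range C \<Longrightarrow> cinner (x - p) l = 0" for x p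
  proof -
    have d: "P x - p \<in> range C" using csubspace_diff [OF sub P(1) that(1)] .
    have "cinner (P x - p) (P x - p) = cinner (x - p) (P x - p) - cinner (x - P x) (P x - p)"
      by (simp add: cinner_simps)
    also have "\<dots> = 0" using that(2) [OF d] P(2) [OF d] by simp
    finally show ?thesis by simp
  qed
  have sym: "cinner (P x) y = cinner x (P y)" for x y
  proof -
    have "cinner (x - P x) (P y) = 0" "cinner (y - P y) (P x) = 0" using P by auto
    then have "cinner (x - P x) (P y) = 0" "cinner (P x) (y - P y) = 0"
      by (metis cinner_commute complex_cnj_zero)+
    then show ?thesis by (simp add: cinner_simps)
  qed
  have bP: "P \<in> bounded_ops"
  proof (rule bounded_opsI [where K = 1])
    fix x y c
    show "P (x + y) = P x + P y"
    proof (rule uniq)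
      show "P x + P y \<in> range C" using P(1) sub unfolding csubspace_def by blast
      show "cinner (x + y - (P x + P y)) l = 0" if "l \<in> range C" for l
        using P(2) [OF that, of x] P(2) [OF that, of y] by (simp add: cinner_simps)
    qed
    show "P (c *\<^sub>C x) = c *\<^sub>C P x"
    proof (rule uniq)
      show "c *\<^sub>C P x \<in> range C" using P(1) sub unfolding csubspace_def by blast
      show "cinner (c *\<^sub>C x - c *\<^sub>C P x) l = 0" if "l \<in> range C" for l
        using P(2) [OF that, of x] by (simp add: cinner_simps)
    qed
    have "cinner (x - P x) (P x) = 0" using P by auto
    then have "cinner x (P x) = cinner (P x) (P x)" by (simp add: cinner_simps)
    then have "(norm x)\<^sup>2 = (norm (P x))\<^sup>2 + (norm (x - P x))\<^sup>2"
      by (simp add: Re_cinner_self [symmetric] cinner_simps sym)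
    then have "(norm (P x))\<^sup>2 \<le> (norm x)\<^sup>2" using zero_le_power2 [of "norm (x - P x)"] by linarith
    then show "norm (P x) \<le> norm x * 1" by simp
  qed
  have "P \<in> M"
  proof (rule memI [OF bP])
    fix U x assume U: "U \<in> commutant M"
    note bU = commutant_bounded [OF U]
    show "P (U x) = U (P x)"
    proof (rule uniq)
      obtain z where "P x = C z" using P(1) [of x] by blast
      then have "U (P x) = C (U z)" using commute [OF C U] by simp
      then show "U (P x) \<in> range C" by blast
      fix l assume "l \<in> range C"
      then obtain z where z: "l = C z" by blast
      have "cinner (U x - U (P x)) l = cinner (x - P x) (adj U (C z))"
        by (simp add: z cinner_adj [OF bU, symmetric] bounded_opsD [OF bU])
      also have "adj U (C z) = C (adj U z)" using commute [OF C commutant_adj [OF U]] by simp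
      also have "cinner (x - P x) (C (adj U z)) = 0" by (rule P(2)) blast
      finally show "cinner (U x - U (P x)) l = 0" .
    qed
  qed
  moreover have "P (C x) = C x" for x by (rule uniq) auto
  ultimately show ?thesis using P(1) sym by (intro that [of P])
qed

lemma closed_positive_partial_resolvent:
  assumes S: "S \<in> aff M" "densely_defined S" "closed S" "positive_op S"
  obtains P G where "P \<in> M" "G \<in> M" "partial_resolvent P G" "closure (range G) = UNIV"
    "null_space G \<subseteq> null_space (\<lambda>x. P x - G x)" "S = op_quotient (\<lambda>x. P x - G x) G"
proof -
  obtain A B where A: "A \<in> M" and B: "B \<in> M" and null: "null_space B \<subseteq> null_space A"
    and SAB: "S = op_quotient A B"
    using S(1) by (auto simp: aff_def)
  note bA = bounded [OF A] and bB = bounded [OF B]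
  \<comment> \<open>Formally \<open>C = (S + I) B\<close>, so the range of \<open>C\<close> is that
    of \<open>S + I\<close>.\<close>
  define C where "C = (\<lambda>x. B x + A x)"
  have C: "C \<in> M" unfolding C_def by (rule add_closed [OF B A])
  note bC = bounded [OF C]
  have mem: "(B x, A x) \<in> S" for x by (auto simp: SAB op_quotient_def)
  have norm_C: "(norm (B x))\<^sup>2 + (norm (A x))\<^sup>2 \<le> (norm (C x))\<^sup>2" for x
    unfolding C_def by (rule positive_op_norm [OF S(4) mem])
  have "range C = (\<lambda>(x, y). x + y) ` S"
    by (force simp: C_def SAB op_quotient_def)
  then have "closed (range C)"
    using closed_range_plus_id [OF _ S(4) S(3)] op_quotient_unbounded_op [OF bA bB null] SAB by simp
  then obtain P where P: "P \<in> M" "\<And>x. P x \<in> range C" "\<And>x. P (C x) = C x"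
    "\<And>x y. cinner (P x) y = cinner x (P y)"
    using range_projection [OF C] by metis
  \<comment> \<open>\<open>X\<close> inverts \<open>C\<close> from the right on its closed range.
    Another choice would alter \<open>X x\<close> by a null vector of \<open>C\<close>, where
    \<open>A\<close> and \<open>B\<close> vanish by \<open>norm_C\<close>, so \<open>G = B X\<close>
    does not depend on it.\<close>
  have "range P \<subseteq> range C" using P(2) by blast
  then obtain X where X: "X \<in> M" "\<And>x. P x = C (X x)"
    using Douglas_factorization [OF P(1) C] by metis
  define G where "G = (\<lambda>x. B (X x))"
  have G: "G \<in> M" unfolding G_def by (rule comp_closed [OF B X(1)])
  note bP = bounded [OF P(1)] and bG = bounded [OF G]
  have C_inj: "B x = B y \<and> A x = A y" if "C x = C y" for x y
  proof -
    have "C (x - y) = 0" using that by (simp add: bounded_opsD [OF bC])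
    then have "(norm (B (x - y)))\<^sup>2 + (norm (A (x - y)))\<^sup>2 \<le> 0" using norm_C [of "x - y"] by simp
    then show ?thesis by (simp add: sum_power2_le_zero_iff bounded_opsD [OF bA] bounded_opsD [OF bB])
  qed
  have GC: "G (C y) = B y" for y
    using C_inj [of "X (C y)" y] X(2) [of "C y"] P(3) by (simp add: G_def)
  have PG: "P x - G x = A (X x)" for x by (simp add: X(2) C_def G_def)
  have GP: "G (P x) = G x" for x using GC [of "X x"] by (simp add: X(2)) (simp add: G_def)
  have rangeG: "range G = range B" using GC by (auto simp: G_def) (metis rangeI)
  \<comment> \<open>With \<open>y = G x\<close> this reads
    \<open><y, (S + I) y> = <y, S y> + |y|^2\<close>. It turns positivity of \<open>S\<close> into
    symmetry of \<open>P G\<close> and the norm inequality.\<close>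
  have form: "cinner (P (G x)) x = cinner (B (X x)) (A (X x)) + complex_of_real ((norm (G x))\<^sup>2)" for x
  proof -
    have "cinner (P (G x)) x = cinner (B (X x)) (P x)" by (simp add: P(4) G_def)
    also have "P x = B (X x) + A (X x)" by (simp add: X(2) C_def)
    finally show ?thesis by (simp add: cinner_simps cinner_self G_def)
  qed
  have pos: "cinner (B x) (A x) \<in> \<real>\<^sub>\<ge>\<^sub>0" for x
  proof -
    have "cinner (A x) (B x) \<in> \<real>\<^sub>\<ge>\<^sub>0" using S(4) mem [of x] unfolding positive_op_def by blast
    then show ?thesis by (subst cinner_commute) (simp add: complex_nonneg_Reals_iff)
  qed
  have "partial_resolvent P G"
    unfolding partial_resolvent_def
  proof (intro conjI allI bP bG P(4) GP)
    show "P (P x) = P x" for x by (simp add: X(2) [of x] P(3))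
    have "cinner (P (G x)) x \<in> \<real>" for x
      unfolding form using pos [of "X x"] by (intro Reals_add) auto
    then show "cinner (P (G x)) y = cinner x (P (G y))" for x y
      using real_form_symmetric [of "\<lambda>x. P (G x)"] bounded_ops_comp [OF bP bG] by blast
    show "(norm (G x))\<^sup>2 \<le> Re (cinner (P (G x)) x)" for x
      unfolding form using pos [of "X x"] by (simp add: complex_nonneg_Reals_iff del: of_real_power)
  qed
  moreover have "closure (range G) = UNIV"
  proof -
    have "Domain S = range B" by (auto simp: SAB op_quotient_def Domain_iff)
    then show ?thesis using S(2) by (simp add: densely_defined_def rangeG)
  qed
  moreover have "null_space G \<subseteq> null_space (\<lambda>x. P x - G x)"
    unfolding PG using null by (auto simp: null_space_def G_def)
  moreover have "S = op_quotient (\<lambda>x. P x - G x) G"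
  proof
    show "S \<subseteq> op_quotient (\<lambda>x. P x - G x) G"
    proof
      fix q assume "q \<in> S"
      then obtain y where "q = (B y, A y)" by (auto simp: SAB op_quotient_def)
      then have "q = (G (C y), P (C y) - G (C y))" by (simp add: GC P(3)) (simp add: C_def)
      then show "q \<in> op_quotient (\<lambda>x. P x - G x) G" by (auto simp: op_quotient_def)
    qed
    show "op_quotient (\<lambda>x. P x - G x) G \<subseteq> S"
      using mem by (auto simp: op_quotient_def PG) (simp add: G_def)
  qed
  ultimately show ?thesis using P(1) G by (intro that [of P G])
qed

end

text \<open>The norm inequality in \<open>partial_resolvent\<close> is positivity in disguise: the
  form at \<open>G x\<close> is the difference of its two sides.\<close>

lemma partial_resolvent_positive_op:
  assumes PG: "partial_resolvent P G"
  shows "positive_op (op_quotient (\<lambda>x. P x - G x) G)"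
proof -
  have "cinner (P x - G x) (G x) \<in> \<real>\<^sub>\<ge>\<^sub>0" for x
  proof -
    have "cinner (P x) (G x) = cinner (P (G x)) x"
      using P_symmetric [OF PG] PG_symmetric [OF PG] by metis
    then have "cinner (P x - G x) (G x) = complex_of_real (Re (cinner (P (G x)) x) - (norm (G x))\<^sup>2)"
      using PG_real [OF PG, of x] by (simp add: cinner_simps cinner_self)
    then show ?thesis using G_norm [OF PG, of x] by (simp del: of_real_diff)
  qed
  then show ?thesis by (auto simp: positive_op_def op_quotient_def)
qed

text \<open>The graph is the solution set of two equations in bounded operators,
  \<open>P (u + v) = u + v\<close> and \<open>G (u + v) = u\<close>.\<close>

lemma partial_resolvent_closed:
  fixes P G :: "'h::complex_hilbert \<Rightarrow> 'h"
  assumes PG: "partial_resolvent P G"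
  shows "closed (op_quotient (\<lambda>x. P x - G x) G)"
proof -
  have "(u, v) \<in> op_quotient (\<lambda>x. P x - G x) G \<longleftrightarrow> P (u + v) = u + v \<and> G (u + v) = u" for u v
  proof
    assume "(u, v) \<in> op_quotient (\<lambda>x. P x - G x) G"
    then obtain x where "u = G x" "v = P x - G x" by (auto simp: op_quotient_def)
    then have "u + v = P x" "u = G x" by auto
    then show "P (u + v) = u + v \<and> G (u + v) = u"
      using P_idem [OF PG] G_P [OF PG] by simp
  next
    assume "P (u + v) = u + v \<and> G (u + v) = u"
    then have "(u, v) = (G (u + v), P (u + v) - G (u + v))" by simp
    then show "(u, v) \<in> op_quotient (\<lambda>x. P x - G x) G" unfolding op_quotient_def by blast
  qed
  then have "op_quotient (\<lambda>x. P x - G x) G =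
      {q. P (fst q + snd q) = fst q + snd q} \<inter> {q. G (fst q + snd q) = fst q}" by auto
  moreover have "continuous_on UNIV (\<lambda>q. P (fst q + snd q))" "continuous_on UNIV (\<lambda>q. G (fst q + snd q))"
    by (intro bounded_linear.continuous_on [OF bounded_opsD(6) [OF P_bounded [OF PG]]]
        bounded_linear.continuous_on [OF bounded_opsD(6) [OF G_bounded [OF PG]]]
        continuous_on_add continuous_on_fst continuous_on_snd continuous_on_id)+
  ultimately show ?thesis
    by (simp add: closed_Int closed_Collect_eq continuous_on_add continuous_on_fst continuous_on_snd continuous_on_id)
qed

lemma resolvents_psd_op:
  assumes "R \<in> resolvents P G" shows "psd_op R" "R (P x) = G x"
  using assms by (auto simp: resolvents_def pos_contraction_def)

section \<open>Transport of partial resolvents and their least solutions along the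
  homomorphism\<close>

context normal_hom
begin

text \<open>The only clause that is not an algebraic identity is the norm inequality. It is recast
  as the operator inequality \<open>adj G G \<le> P G\<close>, to which \<open>hom_op_le\<close>
  applies.\<close>

lemma hom_partial_resolvent:
  assumes P: "P \<in> M" and G: "G \<in> M" and PG: "partial_resolvent P G"
  shows "partial_resolvent (\<Phi> P) (\<Phi> G)"
proof -
  note bG' = N.bounded [OF hom_closed [OF G]]
  have PGM: "(\<lambda>x. P (G x)) \<in> M" by (rule M.comp_closed [OF P G])
  have sa: "P \<in> self_adjoint_part M" "(\<lambda>x. P (G x)) \<in> self_adjoint_part M"
    using P PGM P_symmetric [OF PG] PG_symmetric [OF PG] by (auto simp: M.self_adjoint_part_iff)
  have GG: "(\<lambda>x. adj G (G x)) \<in> self_adjoint_part M"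
    using M.comp_closed [OF M.adj_closed [OF G] G]
    by (simp add: M.self_adjoint_part_iff cinner_adj' [OF M.bounded [OF G]] cinner_adj [OF M.bounded [OF G], symmetric])
  have "op_le (\<lambda>x. adj G (G x)) (\<lambda>x. P (G x))"
    unfolding op_le_def
  proof
    fix x
    have "cinner (P (G x) - adj G (G x)) x = complex_of_real (Re (cinner (P (G x)) x) - (norm (G x))\<^sup>2)"
      using PG_real [OF PG, of x] by (simp add: cinner_simps cinner_adj' [OF M.bounded [OF G]] cinner_self)
    then show "cinner (P (G x) - adj G (G x)) x \<in> \<real>\<^sub>\<ge>\<^sub>0"
      using G_norm [OF PG, of x] by (simp del: of_real_diff)
  qed
  then have "op_le (\<Phi> (\<lambda>x. adj G (G x))) (\<Phi> (\<lambda>x. P (G x)))" by (rule hom_op_le [OF GG sa(2)])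
  then have le: "op_le (\<lambda>x. adj (\<Phi> G) (\<Phi> G x)) (\<lambda>x. \<Phi> P (\<Phi> G x))"
    by (simp add: hom_comp' hom_adj P G M.adj_closed)
  have idem: "\<Phi> P (\<Phi> P x) = \<Phi> P x" for x
    using hom_comp' [OF P P] P_idem [OF PG] by (simp add: fun_eq_iff)
  have GP: "\<Phi> G (\<Phi> P x) = \<Phi> G x" for x
    using hom_comp' [OF G P] G_P [OF PG] by (simp add: fun_eq_iff)
  show ?thesis
    unfolding partial_resolvent_def
  proof (intro conjI allI bG' idem GP)
    show "\<Phi> P \<in> bounded_ops" by (rule N.bounded [OF hom_closed [OF P]])
    show "cinner (\<Phi> P x) y = cinner x (\<Phi> P y)" for x y
      using hom_self_adjoint [OF sa(1)] by (simp add: N.self_adjoint_part_iff)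
    show "cinner (\<Phi> P (\<Phi> G x)) y = cinner x (\<Phi> P (\<Phi> G y))" for x y
      using hom_self_adjoint [OF sa(2)] by (simp add: N.self_adjoint_part_iff hom_comp' P G)
    show "(norm (\<Phi> G x))\<^sup>2 \<le> Re (cinner (\<Phi> P (\<Phi> G x)) x)" for x
      using le by (simp add: op_le_def complex_nonneg_Reals_iff cinner_simps cinner_adj' [OF bG'] Re_cinner_self)
  qed
qed

text \<open>Density of the range of \<open>G\<close> means that \<open>adj G\<close> is injective,
  that is, its null space lies in that of \<open>id\<close>; \<open>hom_null_space\<close> preserves
  such inclusions.\<close>

lemma hom_dense_range:
  assumes G: "G \<in> M" and dense: "closure (range G) = UNIV"
  shows "closure (range (\<Phi> G)) = UNIV"
proof (rule dense_of_orthogonal)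
  note bG' = N.bounded [OF hom_closed [OF G]]
  show "csubspace (range (\<Phi> G))" by (rule csubspace_range [OF bG'])
  have "null_space (adj G) \<subseteq> null_space id"
  proof
    fix z assume "z \<in> null_space (adj G)"
    then have "cinner z l = 0" if "l \<in> range G" for l
      using that by (auto simp: null_space_def cinner_adj' [OF M.bounded [OF G], symmetric])
    then have "z = 0" by (rule orthogonal_dense [OF dense])
    then show "z \<in> null_space id" by (simp add: null_space_def)
  qed
  then have sub: "null_space (adj (\<Phi> G)) \<subseteq> {0}"
    using hom_null_space [OF M.id_closed M.adj_closed [OF G]] by (simp add: hom_adj G hom_id null_space_def)
  fix z assume z: "\<And>l. l \<in> range (\<Phi> G) \<Longrightarrow> cinner z l = 0"
  have "adj (\<Phi> G) z = 0"
  proof (rule cinner_ext)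
    show "cinner (adj (\<Phi> G) z) y = cinner 0 y" for y
      using z by (simp add: cinner_adj' [OF bG'])
  qed
  then show "z = 0" using sub by (auto simp: null_space_def)
qed

lemma hom_resolvent_approx:
  assumes P: "P \<in> M" and G: "G \<in> M"
  shows "resolvent_approx P G n \<in> M"
    and "\<Phi> (resolvent_approx P G n) = resolvent_approx (\<Phi> P) (\<Phi> G) n"
proof -
  define E where "E = (\<lambda>x. x - P (G x))"
  have E: "E \<in> M" unfolding E_def by (rule M.diff_closed [OF M.ident_closed M.comp_closed [OF P G]])
  have EG: "(\<lambda>x. (E ^^ k) (adj G x)) \<in> M" for k
    by (rule M.comp_closed [OF M.funpow_closed [OF E] M.adj_closed [OF G]])
  have GEG: "(\<lambda>x. G ((E ^^ k) (adj G x))) \<in> M" for k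
    by (rule M.comp_closed [OF G EG])
  have eq: "resolvent_approx P G n = (\<lambda>x. \<Sum>k<n. G ((E ^^ k) (adj G x)))"
    by (simp add: fun_eq_iff resolvent_approx_def E_def)
  show "resolvent_approx P G n \<in> M" unfolding eq by (rule M.sum_closed [OF GEG])
  have PhiE: "\<Phi> E = (\<lambda>x. x - \<Phi> P (\<Phi> G x))"
    unfolding E_def by (simp add: hom_diff [OF M.ident_closed M.comp_closed [OF P G]] hom_ident hom_comp' [OF P G])
  have "\<Phi> (\<lambda>x. G ((E ^^ k) (adj G x))) = (\<lambda>x. \<Phi> G ((\<Phi> E ^^ k) (adj (\<Phi> G) x)))" for k
    by (simp add: hom_comp' [OF G EG] hom_comp' [OF M.funpow_closed [OF E] M.adj_closed [OF G]] hom_funpow [OF E] hom_adj [OF G])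
  then show "\<Phi> (resolvent_approx P G n) = resolvent_approx (\<Phi> P) (\<Phi> G) n"
    unfolding eq hom_sum [of "\<lambda>k x. G ((E ^^ k) (adj G x))", OF GEG]
    by (simp add: fun_eq_iff resolvent_approx_def PhiE)
qed

text \<open>Minimality of \<open>\<Phi> L\<close> is claimed against all resolvents on the target
  space, whether or not they come from \<open>M\<close>. It holds because \<open>\<Phi> L\<close> is
  the limit of the approximants built from \<open>\<Phi> P\<close> and \<open>\<Phi> G\<close>, to
  which \<open>least_resolvent\<close> applies directly.\<close>

lemma hom_least_resolvent:
  assumes P: "P \<in> M" and G: "G \<in> M" and PG: "partial_resolvent P G"
  obtains L where "L \<in> M" "L \<in> resolvents P G" "\<And>R. R \<in> resolvents P G \<Longrightarrow> op_le L R"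
    "\<Phi> L \<in> resolvents (\<Phi> P) (\<Phi> G)" "\<And>R. R \<in> resolvents (\<Phi> P) (\<Phi> G) \<Longrightarrow> op_le (\<Phi> L) R"
proof -
  note PG' = hom_partial_resolvent [OF P G PG]
  obtain L where L: "L \<in> resolvents P G" "\<And>x. (\<lambda>n. resolvent_approx P G n x) \<longlonglongrightarrow> L x"
    "\<And>R. psd_op R \<Longrightarrow> (\<And>x. R (P x) = G x) \<Longrightarrow> op_le L R"
    using least_resolvent [OF PG] by metis
  obtain L' where L': "L' \<in> resolvents (\<Phi> P) (\<Phi> G)" "\<And>x. (\<lambda>n. resolvent_approx (\<Phi> P) (\<Phi> G) n x) \<longlonglongrightarrow> L' x"
    "\<And>R. psd_op R \<Longrightarrow> (\<And>x. R (\<Phi> P x) = \<Phi> G x) \<Longrightarrow> op_le L' R"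
    using least_resolvent [OF PG'] by metis
  have sa: "resolvent_approx P G n \<in> self_adjoint_part M" for n
    using hom_resolvent_approx(1) [OF P G] resolvent_approx_symmetric [OF PG]
    by (simp add: M.self_adjoint_part_iff)
  have bL: "L \<in> bounded_ops" using L(1) by (rule resolvents_bounded)
  have LM: "L \<in> M" using M.self_adjoint_strong_limit [OF sa bL L(2)] by (simp add: M.self_adjoint_part_iff)
  have "\<Phi> L = L'"
  proof
    fix y
    have "(\<lambda>n. resolvent_approx (\<Phi> P) (\<Phi> G) n y) \<longlonglongrightarrow> \<Phi> L y"
      using hom_strong_limit [OF sa bL L(2) resolvent_approx_increasing [OF PG]]
      by (simp add: hom_resolvent_approx(2) [OF P G])
    then show "\<Phi> L y = L' y" using L'(2) by (rule LIMSEQ_unique)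
  qed
  then have L'': "\<Phi> L \<in> resolvents (\<Phi> P) (\<Phi> G)" using L'(1) by simp
  have "op_le L R" if "R \<in> resolvents P G" for R
    using L(3) resolvents_psd_op [OF that] by blast
  moreover have "op_le (\<Phi> L) R" if "R \<in> resolvents (\<Phi> P) (\<Phi> G)" for R
    using L'(3) resolvents_psd_op [OF that] \<open>\<Phi> L = L'\<close> by blast
  ultimately show ?thesis
    using LM L(1) L'' by (intro that [of L])
qed

text \<open>The range of \<open>R\<close> contains that of \<open>G\<close> and is dense, so the
  symmetric operator \<open>R\<close> is injective. This is the null space condition under which
  \<open>aff_map_op_quotient\<close> evaluates the quotient of \<open>I - R\<close> by
  \<open>R\<close>.\<close>

lemma aff_map_op_of_resolvent:
  assumes P: "P \<in> M" and G: "G \<in> M" and dense: "closure (range G) = UNIV"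
    and R: "R \<in> M" "R \<in> resolvents P G"
  shows "aff_map M \<Phi> (op_of_resolvent R) = op_of_resolvent (\<Phi> R)"
proof -
  have c: "pos_contraction R" and "\<And>x. R (P x) = G x" using R(2) by (auto simp: resolvents_def)
  then have "range G \<subseteq> range R" by (metis image_subsetI rangeI)
  then have "closure (range R) = UNIV" using dense closure_mono by blast
  then have "null_space R \<subseteq> {0}"
    using pos_contraction_symmetric [OF c] by (intro symmetric_dense_range_injective)
  then have "null_space R \<subseteq> null_space (\<lambda>x. x - R x)"
    using bounded_opsD(5) [OF M.bounded [OF R(1)]] by (auto simp: null_space_def)
  then have "aff_map M \<Phi> (op_quotient (\<lambda>x. x - R x) R) = op_quotient (\<Phi> (\<lambda>x. x - R x)) (\<Phi> R)"
    by (intro aff_map_op_quotient M.diff_closed M.ident_closed R(1))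
  then show ?thesis by (simp add: op_of_resolvent_def hom_diff M.ident_closed R(1) hom_ident)
qed

end

theorem theorem7p8:
  fixes M :: "('h::complex_hilbert \<Rightarrow> 'h) set"
    and N :: "('k::complex_hilbert \<Rightarrow> 'k) set"
    and \<Phi> :: "('h \<Rightarrow> 'h) \<Rightarrow> ('k \<Rightarrow> 'k)"
    and S :: "('h \<times> 'h) set"
  assumes "von_neumann_algebra M" and "von_neumann_algebra N"
    and "unital_star_hom M N \<Phi>" and "normal_map M N \<Phi>"
    and "S \<in> aff M" and "densely_defined S" and "closed S" and "positive_op S"
  shows "(aff_map M \<Phi> S \<in> aff N \<and> densely_defined (aff_map M \<Phi> S) \<and>
            closed (aff_map M \<Phi> S) \<and> positive_op (aff_map M \<Phi> S)) \<and>
         aff_map M \<Phi> (krein_ext S) = krein_ext (aff_map M \<Phi> S) \<and>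
         aff_map M \<Phi> (friedrichs_ext S) = friedrichs_ext (aff_map M \<Phi> S)"
proof -
  interpret normal_hom M N \<Phi> using assms by unfold_locales
  obtain P G where P: "P \<in> M" and G: "G \<in> M" and PG: "partial_resolvent P G"
    and dense: "closure (range G) = UNIV" and null: "null_space G \<subseteq> null_space (\<lambda>x. P x - G x)"
    and S: "S = op_quotient (\<lambda>x. P x - G x) G"
    using M.closed_positive_partial_resolvent [OF assms(5-8)] by metis
  have PmG: "(\<lambda>x. P x - G x) \<in> M" by (rule M.diff_closed [OF P G])
  have Phi: "\<Phi> (\<lambda>x. P x - G x) = (\<lambda>x. \<Phi> P x - \<Phi> G x)" by (rule hom_diff [OF P G])
  have S': "aff_map M \<Phi> S = op_quotient (\<lambda>x. \<Phi> P x - \<Phi> G x) (\<Phi> G)"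
    unfolding S aff_map_op_quotient [OF PmG G null] Phi ..
  note PG' = hom_partial_resolvent [OF P G PG] and dense' = hom_dense_range [OF G dense]
  have "null_space (\<Phi> G) \<subseteq> null_space (\<lambda>x. \<Phi> P x - \<Phi> G x)"
    using hom_null_space [OF PmG G null] by (simp add: Phi)
  then have "aff_map M \<Phi> S \<in> aff N"
    unfolding S' aff_def using hom_closed [OF PmG] hom_closed [OF G] by (auto simp: Phi)
  moreover have "Domain (aff_map M \<Phi> S) = range (\<Phi> G)"
    by (auto simp: S' op_quotient_def Domain_iff)
  moreover have "aff_map M \<Phi> (friedrichs_ext S) = friedrichs_ext (aff_map M \<Phi> S)"
  proof -
    obtain L where L: "L \<in> M" "L \<in> resolvents P G" "\<And>R. R \<in> resolvents P G \<Longrightarrow> op_le L R"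
      "\<Phi> L \<in> resolvents (\<Phi> P) (\<Phi> G)" "\<And>R. R \<in> resolvents (\<Phi> P) (\<Phi> G) \<Longrightarrow> op_le (\<Phi> L) R"
      using hom_least_resolvent [OF P G PG] by metis
    have "friedrichs_ext S = op_of_resolvent L"
      unfolding S by (intro friedrichs_ext_resolvent dense L(2,3))
    moreover have "friedrichs_ext (aff_map M \<Phi> S) = op_of_resolvent (\<Phi> L)"
      unfolding S' by (intro friedrichs_ext_resolvent dense' L(4,5))
    ultimately show ?thesis using aff_map_op_of_resolvent [OF P G dense L(1,2)] by simp
  qed
  moreover have "aff_map M \<Phi> (krein_ext S) = krein_ext (aff_map M \<Phi> S)"
  proof -
    \<comment> \<open>\<open>H\<close> belongs to the inverse of \<open>S\<close>; its least
      resolvent is that of the Friedrichs extension of the inverse, read as a linear relation where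
      it is multivalued.\<close>
    define H where "H = (\<lambda>x. P x - G x)"
    have H: "H \<in> M" "partial_resolvent P H" "\<Phi> H = (\<lambda>x. \<Phi> P x - \<Phi> G x)"
      using PmG partial_resolvent_complement [OF PG] Phi by (simp_all add: H_def)
    obtain L where L: "L \<in> M" "L \<in> resolvents P H" "\<And>R. R \<in> resolvents P H \<Longrightarrow> op_le L R"
      "\<Phi> L \<in> resolvents (\<Phi> P) (\<Phi> H)" "\<And>R. R \<in> resolvents (\<Phi> P) (\<Phi> H) \<Longrightarrow> op_le (\<Phi> L) R"
      using hom_least_resolvent [OF P H(1,2)] by metis
    define K where "K = (\<lambda>x. x - L x)"
    have KM: "K \<in> M" unfolding K_def by (intro M.diff_closed M.ident_closed L(1))
    have PhiK: "\<Phi> K = (\<lambda>x. x - \<Phi> L x)"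
      unfolding K_def by (simp add: hom_diff M.ident_closed L(1) hom_ident)
    \<comment> \<open>Complementing twice returns to \<open>G\<close>, since
      \<open>P - (P - G) = G\<close>.\<close>
    have K: "K \<in> resolvents P G" "\<Phi> K \<in> resolvents (\<Phi> P) (\<Phi> G)"
      using resolvent_complement [OF partial_resolvent_complement [OF PG] L(2) [unfolded H_def]]
        resolvent_complement [OF partial_resolvent_complement [OF PG'] L(4) [unfolded H(3)]]
      by (simp_all add: PhiK) (simp add: K_def)
    have gK: "op_le R K" if "R \<in> resolvents P G" for R
      using L(3) [unfolded H_def, OF resolvent_complement [OF PG that]] by (simp add: op_le_def K_def algebra_simps)
    have gK': "op_le R (\<Phi> K)" if "R \<in> resolvents (\<Phi> P) (\<Phi> G)" for R
      using L(5) [unfolded H(3), OF resolvent_complement [OF PG' that]] by (simp add: op_le_def PhiK algebra_simps)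
    have "krein_ext S = op_of_resolvent K"
      unfolding S by (intro krein_ext_resolvent dense K(1) gK)
    moreover have "krein_ext (aff_map M \<Phi> S) = op_of_resolvent (\<Phi> K)"
      unfolding S' by (intro krein_ext_resolvent dense' K(2) gK')
    ultimately show ?thesis using aff_map_op_of_resolvent [OF P G dense KM K(1)] by simp
  qed
  ultimately show ?thesis
    using dense' partial_resolvent_closed [OF PG'] partial_resolvent_positive_op [OF PG']
    by (simp add: densely_defined_def S')
qed

end
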